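(* For functions $\theta,\psi$ of one variable, analytic near the origin, let $\phi$ be defined by $$\phi(t^2,x^2)=\frac{\psi(x)}{\cos t}\,\sqrt{\frac{t^2-\theta^2(x)}{\tan^2 t-x^2}}\,,$$ i.e. $\phi$ is obtained by solving $\cos^2 t\,(\tan^2 t-x^2)\,\phi^2(t^2,x^2)=\psi^2(x)\,(t^2-\theta^2(x))$ for $\phi$. Consider the task of finding (i) a function $\theta$, analytic in a neighborhood of the origin, such that $\phi$ is analytic in a neighborhood of the origin, and (ii) a function $\psi$ such that $\phi$ is a small perturbation of the identity in the sense that $\phi(0,\cdot)=1$. The unique choice $$\theta(x)=\arctan x\qquad\text{and}\qquad\psi(x)=\frac{x}{\arctan x}$$ fulfills these conditions (this choice of $\theta$ is necessary and sufficient for analyticity of $\phi$ near the origin, and this choice of $\psi$ is then necessary and sufficient for $\phi(0,\cdot)=1$). With this choice, $$\phi(t^2,x^2)=\frac{x}{\arctan x}\,\sqrt{\frac{(1+\tan^2 t)\,(t^2-\arctan^2 x)}{\tan^2 t-x^2}}\,,$$ and, moreover, the coefficients of the Maclaurin expansion of $\phi$ with respect to $t$ are bounded functions of $x$. Consequently, the operator $\phi(T^2,X^2)$ with $T=-\mathrm{i}h\partial_t/2$ and $X=-\mathrm{i}h\partial_x/2$, when expanded and truncated at any finite order in $T$, has coefficients which are bounded operators in space.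
   Context: Here $t,x$ are real variables, $h>0$ is the time step, $\mathrm{i}$ is the imaginary unit, and the spatial variable of the operators lives on the circle; functions of $X$ are Fourier multipliers in space. The value of $x/\arctan x$ at $x=0$ is $1$, and quotients are understood as extended by continuity at removable singularities. Such a $\phi$ arises as the generating function of a near-identity change of variables $u_h=\phi(T^2,X^2)u$ that removes time derivatives of order larger than two from the modified Lagrangian of the implicit midpoint rule applied to the linear wave equation.
   Formalization: Since only θ² enters φ, θ = −arctan x works equally well, so uniqueness and necessity of θ = arctan x are proved up to sign; the necessity of this θ for analyticity alone is stated for ψ not identically zero, because ψ = 0 gives φ = 0 for every θ. *)

theory Defs
  imports "HOL-Analysis.Analysis"
begin

text \<open>Real-analyticity in a neighbourhood of the origin: every point of some neighbourhood is the
  centre of a convergent power series representing the function near that point. Values are complex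
  because the square root below may have a negative radicand for a general \<open>\<theta>\<close>.
  \<open>has_sum\<close> is unconditional (hence absolute) convergence of the double series.\<close>

definition analytic_near_0 :: "(real \<Rightarrow> complex) \<Rightarrow> bool" where
  "analytic_near_0 f \<longleftrightarrow>
     (\<exists>r>0. \<forall>p. \<bar>p\<bar> < r \<longrightarrow>
       (\<exists>(a :: nat \<Rightarrow> complex) \<rho>. \<rho> > 0 \<and>
         (\<forall>x. \<bar>x - p\<bar> < \<rho> \<longrightarrow> (\<lambda>n. a n * complex_of_real (x - p) ^ n) sums f x)))"

definition analytic_near_00 :: "(real \<Rightarrow> real \<Rightarrow> complex) \<Rightarrow> bool" where
  "analytic_near_00 f \<longleftrightarrow>
     (\<exists>r>0. \<forall>p q. \<bar>p\<bar> < r \<and> \<bar>q\<bar> < r \<longrightarrow>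
       (\<exists>(a :: nat \<Rightarrow> nat \<Rightarrow> complex) \<rho>. \<rho> > 0 \<and>
         (\<forall>x y. \<bar>x - p\<bar> < \<rho> \<and> \<bar>y - q\<bar> < \<rho> \<longrightarrow>
           ((\<lambda>(i, j). a i j * complex_of_real (x - p) ^ i * complex_of_real (y - q) ^ j)
              has_sum f x y) UNIV)))"

text \<open>The formula defining \<open>\<phi>\<close>, required near the origin wherever its denominator is nonzero. The
  values of \<open>\<phi>\<close> on \<open>tan\<^sup>2 t = x\<^sup>2\<close> are left free: an analytic \<open>\<phi>\<close> is there the continuous
  extension of the quotient. \<open>\<phi>\<close> is a function of the two arguments \<open>a = t\<^sup>2\<close> and \<open>b = x\<^sup>2\<close>.\<close>

definition defines_phi ::
  "(real \<Rightarrow> complex) \<Rightarrow> (real \<Rightarrow> complex) \<Rightarrow> (real \<Rightarrow> real \<Rightarrow> complex) \<Rightarrow> bool" where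
  "defines_phi \<theta> \<psi> \<phi> \<longleftrightarrow>
     (\<forall>\<^sub>F (t, x) in nhds (0, 0). (tan t)\<^sup>2 \<noteq> x\<^sup>2 \<longrightarrow>
        \<phi> (t\<^sup>2) (x\<^sup>2) =
          \<psi> x / complex_of_real (cos t) *
          csqrt ((complex_of_real (t\<^sup>2) - (\<theta> x)\<^sup>2) / complex_of_real ((tan t)\<^sup>2 - x\<^sup>2)))"

definition arctan_quot :: "real \<Rightarrow> real" where
  "arctan_quot x = (if x = 0 then 1 else x / arctan x)"

text \<open>Only \<open>\<theta>\<^sup>2\<close> enters \<open>\<phi>\<close>, so \<open>\<theta> = arctan\<close> can only be determined up to its sign.\<close>

definition arctan_up_to_sign :: "(real \<Rightarrow> complex) \<Rightarrow> bool" where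
  "arctan_up_to_sign \<theta> \<longleftrightarrow>
     (\<forall>\<^sub>F x in nhds 0. \<theta> x = complex_of_real (arctan x)) \<or>
     (\<forall>\<^sub>F x in nhds 0. \<theta> x = - complex_of_real (arctan x))"

definition phi_formula :: "real \<Rightarrow> real \<Rightarrow> real" where
  "phi_formula t x =
     arctan_quot x * sqrt ((1 + (tan t)\<^sup>2) * (t\<^sup>2 - (arctan x)\<^sup>2) / ((tan t)\<^sup>2 - x\<^sup>2))"

text \<open>Extension by continuity of \<open>phi_formula\<close>; for fixed \<open>x\<close> its singularities in \<open>t\<close> are isolated.
  Unlike the germ \<open>\<phi>\<close> above, this is meaningful for every real \<open>x\<close>.\<close>

definition phi_mid :: "real \<Rightarrow> real \<Rightarrow> real" where
  "phi_mid t x =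
     (if (tan t)\<^sup>2 = x\<^sup>2 then Lim (at t) (\<lambda>s. phi_formula s x) else phi_formula t x)"

definition phi_coeff :: "nat \<Rightarrow> real \<Rightarrow> real" where
  "phi_coeff n x = (deriv ^^ n) (\<lambda>t. phi_mid t x) 0 / fact n"

text \<open>\<open>L\<^sup>2\<close> of the circle of circumference \<open>L\<close>, by representatives on \<open>[0, L)\<close>; identities between
  elements of \<open>L\<^sup>2\<close> hold almost everywhere.\<close>

abbreviation circle_measure :: "real \<Rightarrow> real measure" where
  "circle_measure L \<equiv> lebesgue_on {0..<L}"

definition L2_circle :: "real \<Rightarrow> (real \<Rightarrow> complex) set" where
  "L2_circle L = {u. u \<in> borel_measurable (circle_measure L) \<and>
                     integrable (circle_measure L) (\<lambda>x. (cmod (u x))\<^sup>2)}"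

definition L2_norm_circle :: "real \<Rightarrow> (real \<Rightarrow> complex) \<Rightarrow> real" where
  "L2_norm_circle L u = sqrt (LINT x|circle_measure L. (cmod (u x))\<^sup>2)"

definition bounded_operator_L2 ::
  "real \<Rightarrow> ((real \<Rightarrow> complex) \<Rightarrow> (real \<Rightarrow> complex)) \<Rightarrow> bool" where
  "bounded_operator_L2 L A \<longleftrightarrow>
     (\<forall>u\<in>L2_circle L. A u \<in> L2_circle L) \<and>
     (\<forall>u\<in>L2_circle L. \<forall>v\<in>L2_circle L.
        AE x in circle_measure L. A (\<lambda>y. u y + v y) x = A u x + A v x) \<and>
     (\<forall>u\<in>L2_circle L. \<forall>c.
        AE x in circle_measure L. A (\<lambda>y. c * u y) x = c * A u x) \<and>
     (\<exists>B. \<forall>u\<in>L2_circle L. L2_norm_circle L (A u) \<le> B * L2_norm_circle L u)"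

definition wavenumber :: "real \<Rightarrow> int \<Rightarrow> real" where
  "wavenumber L k = 2 * pi * of_int k / L"

definition fourier_coeff :: "real \<Rightarrow> (real \<Rightarrow> complex) \<Rightarrow> int \<Rightarrow> complex" where
  "fourier_coeff L u k =
     (LINT x|circle_measure L. u x * cis (- (wavenumber L k * x))) / complex_of_real L"

text \<open>The function \<open>f(X)\<close> of \<open>X = - \<i> h \<partial>\<^sub>x / 2\<close> is the Fourier multiplier with symbol
  \<open>f (h \<kappa> / 2)\<close>, because \<open>X exp (\<i> \<kappa> x) = (h \<kappa> / 2) exp (\<i> \<kappa> x)\<close>. The multiplied Fourier series
  is summed in \<open>L\<^sup>2\<close>; \<open>SOME\<close> only selects a representative modulo null sets.\<close>

definition fun_of_X ::
  "real \<Rightarrow> real \<Rightarrow> (real \<Rightarrow> real) \<Rightarrow> (real \<Rightarrow> complex) \<Rightarrow> (real \<Rightarrow> complex)" where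
  "fun_of_X L h f u =
     (SOME v. v \<in> L2_circle L \<and>
        (\<lambda>K. L2_norm_circle L (\<lambda>x. v x -
            (\<Sum>k = - int K..int K. complex_of_real (f (h * wavenumber L k / 2)) *
                fourier_coeff L u k * cis (wavenumber L k * x)))) \<longlonglongrightarrow> 0)"

text \<open>\<open>T = - \<i> h \<partial>\<^sub>t / 2\<close>, acting on functions \<open>u t x\<close> of time and space.\<close>

definition time_op :: "real \<Rightarrow> (real \<Rightarrow> real \<Rightarrow> complex) \<Rightarrow> (real \<Rightarrow> real \<Rightarrow> complex)" where
  "time_op h u = (\<lambda>t x. - \<i> * complex_of_real h / 2 * vector_derivative (\<lambda>s. u s x) (at t))"

text \<open>\<open>\<phi>(T\<^sup>2, X\<^sup>2)\<close>, expanded and truncated at order \<open>N\<close> in \<open>T\<close>.\<close>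

definition truncated_phi ::
  "real \<Rightarrow> real \<Rightarrow> nat \<Rightarrow> (real \<Rightarrow> real \<Rightarrow> complex) \<Rightarrow> (real \<Rightarrow> real \<Rightarrow> complex)" where
  "truncated_phi L h N u =
     (\<lambda>t x. \<Sum>n\<le>N. fun_of_X L h (phi_coeff n) ((time_op h ^^ n) u t) x)"

end

theory Submission
  imports Defs "HOL-Complex_Analysis.Complex_Analysis"
begin

text \<open>
  Write \<open>x = tan s\<close> with \<open>s = arctan x\<close>. Since \<open>tan t \<mp> tan s = sin (t \<mp> s) / (cos t cos s)\<close>, the
  quotient under the root is \<open>(cos t cos s)\<^sup>2 / (sinc (t - s) sinc (t + s))\<close> if \<open>\<theta> = arctan\<close>
  (\<open>midpoint_quotient\<close>), where \<open>sinc z = sin z / z\<close>. On the disc of radius \<open>pi\<close> the function \<open>sinc\<close>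
  has no zeros, so it has a holomorphic inverse square root \<open>F\<close>, which is even and positive on the
  reals (\<open>inv_sqrt_sinc\<close>). Hence \<open>\<phi>(t\<^sup>2, x\<^sup>2) = \<psi>(x) cos s F(t - s) F(t + s)\<close>, and for
  \<open>\<psi>(x) = x / arctan x\<close> the factor \<open>\<psi>(x) cos s\<close> is \<open>sinc s\<close>. The removable singularities on
  \<open>tan\<^sup>2 t = x\<^sup>2\<close> have disappeared from this formula, and the claims can be read off from it.

  \<^emph>\<open>Sufficiency.\<close> For even \<open>\<psi>\<close> the formula extends to small complex \<open>t\<close> and \<open>x\<close>, is even in each of
  them, and therefore is a separately holomorphic function of \<open>t\<^sup>2\<close> and of \<open>x\<^sup>2\<close>; being bounded it is a
  convergent double power series (\<open>phi_exists\<close>). That \<open>\<psi>\<close> is even is forced as soon as the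
  right-hand side is a function of \<open>x\<^sup>2\<close> (\<open>psi_even\<close>).

  \<^emph>\<open>Necessity.\<close> Squaring the definition and passing to the limit on \<open>tan\<^sup>2 t = x\<^sup>2\<close> gives
  \<open>cos\<^sup>2 t (tan\<^sup>2 t - x\<^sup>2) \<phi>\<^sup>2 = \<psi>\<^sup>2 (t\<^sup>2 - \<theta>\<^sup>2)\<close> near the origin (\<open>defining_identity\<close>). At \<open>t = arctan x\<close>
  the left side vanishes, so \<open>\<psi>\<^sup>2 (arctan\<^sup>2 - \<theta>\<^sup>2) = 0\<close>, and zeros of analytic functions are isolated
  (\<open>theta_necessary\<close>). At \<open>t = 0\<close> the formula reads \<open>\<phi>(0, x\<^sup>2) = \<psi>(x) arctan x / x\<close>, which determines
  \<open>\<psi>\<close> (\<open>normalisation_iff\<close>).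

  \<^emph>\<open>Boundedness.\<close> For every real \<open>x\<close> the function \<open>sinc s F(t - s) F(t + s)\<close> is holomorphic in
  \<open>\<bar>t\<bar> < 3/2\<close>, because \<open>\<bar>t \<plusminus> s\<bar> < 3/2 + pi/2 < pi\<close>, and it is bounded there uniformly in \<open>x\<close>. Cauchy's
  inequality bounds each Taylor coefficient uniformly in \<open>x\<close> (\<open>phi_coeff_bounded\<close>). Finally a Fourier
  multiplier with a bounded symbol is a bounded operator on square-integrable functions: Bessel's
  inequality makes the multiplied Fourier sums a Cauchy sequence, and the space is complete
  (\<open>fun_of_X_bounded\<close>).
\<close>

section \<open>Analytic functions of one real variable near the origin\<close>

text \<open>Together with its converse \<open>analytic_near_0_holomorphicE\<close> this reduces real analyticity near the origin to one holomorphic function on a complex disc, so that the identity theorem applies.\<close>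

lemma analytic_near_0_of_holomorphic:
  assumes "r > 0" and hol: "F holomorphic_on ball 0 r"
    and eq: "\<And>x. \<bar>x\<bar> < r \<Longrightarrow> f x = F (complex_of_real x)"
  shows "analytic_near_0 f"
  unfolding analytic_near_0_def
proof (intro exI[of _ r] conjI allI impI \<open>r > 0\<close>)
  fix p :: real assume p: "\<bar>p\<bar> < r"
  have sub: "ball (complex_of_real p) (r - \<bar>p\<bar>) \<subseteq> ball 0 r"
    by (simp add: ball_subset_ball_iff)
  have "(\<lambda>n. (deriv ^^ n) F (of_real p) / fact n * complex_of_real (x - p) ^ n) sums f x"
    if "\<bar>x - p\<bar> < r - \<bar>p\<bar>" for x
  proof -
    have "complex_of_real x \<in> ball (of_real p) (r - \<bar>p\<bar>)"
      using that by (simp add: dist_norm norm_minus_commute flip: of_real_diff)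
    from holomorphic_power_series[OF holomorphic_on_subset[OF hol sub] this]
    show ?thesis using that p by (subst eq) auto
  qed
  with p show "\<exists>(a :: nat \<Rightarrow> complex) \<rho>. \<rho> > 0 \<and>
         (\<forall>x. \<bar>x - p\<bar> < \<rho> \<longrightarrow> (\<lambda>n. a n * complex_of_real (x - p) ^ n) sums f x)"
    by (intro exI[of _ "\<lambda>n. (deriv ^^ n) F (of_real p) / fact n"] exI[of _ "r - \<bar>p\<bar>"]) auto
qed

text \<open>A power series that converges for all real arguments in an interval also converges on the complex disc with that interval as diameter.\<close>

lemma analytic_near_0_holomorphicE:
  assumes "analytic_near_0 f"
  obtains r F where "r > 0" "F holomorphic_on ball 0 r"
    "\<And>x. \<bar>x\<bar> < r \<Longrightarrow> f x = F (complex_of_real x)"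
proof -
  obtain a r where r: "r > 0"
    and sums: "\<And>x. \<bar>x\<bar> < r \<Longrightarrow> (\<lambda>n. a n * complex_of_real x ^ n) sums f x"
  proof -
    from assms obtain r0 :: real where r0: "r0 > 0" and H: "\<And>p. \<bar>p\<bar> < r0 \<Longrightarrow>
       (\<exists>(a :: nat \<Rightarrow> complex) \<rho>. \<rho> > 0 \<and>
         (\<forall>x. \<bar>x - p\<bar> < \<rho> \<longrightarrow> (\<lambda>n. a n * complex_of_real (x - p) ^ n) sums f x))"
      unfolding analytic_near_0_def by blast
    have "\<bar>0::real\<bar> < r0" using r0 by simp
    from H[OF this] obtain a \<rho> where "\<rho> > 0"
      "\<forall>x. \<bar>x - 0\<bar> < \<rho> \<longrightarrow> (\<lambda>n. a n * complex_of_real (x - 0) ^ n) sums f x" by blast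
    then show thesis by (intro that[of \<rho> a]) simp_all
  qed
  define F where "F = (\<lambda>z. \<Sum>n. a n * z ^ n)"
  have "(\<lambda>n. a n * z ^ n) sums F z" if "norm z < r" for z :: complex
  proof -
    obtain k where k: "norm z < k" "k < r" using dense[OF \<open>norm z < r\<close>] by blast
    then have "summable (\<lambda>n. a n * complex_of_real k ^ n)"
      using sums[of k] norm_ge_zero[of z] by (auto simp: sums_iff)
    then have "summable (\<lambda>n. a n * z ^ n)"
      using k by (intro powser_inside[of a "of_real k" z]) auto
    then show ?thesis by (simp add: F_def summable_sums)
  qed
  then have "F holomorphic_on ball 0 r"
    by (intro power_series_holomorphic[of 0 r a]) auto
  moreover have "f x = F (complex_of_real x)" if "\<bar>x\<bar> < r" for x
    using sums[OF that] by (simp add: F_def sums_iff)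
  ultimately show thesis using r that by blast
qed

lemma analytic_near_0_sub:
  assumes "analytic_near_0 f" "analytic_near_0 g"
  shows "analytic_near_0 (\<lambda>x. f x - g x)"
proof -
  obtain r F where F: "r > 0" "F holomorphic_on ball 0 r"
    "\<And>x. \<bar>x\<bar> < r \<Longrightarrow> f x = F (complex_of_real x)"
    using analytic_near_0_holomorphicE[OF assms(1)] by blast
  obtain s G where G: "s > 0" "G holomorphic_on ball 0 s"
    "\<And>x. \<bar>x\<bar> < s \<Longrightarrow> g x = G (complex_of_real x)"
    using analytic_near_0_holomorphicE[OF assms(2)] by blast
  show ?thesis
  proof (rule analytic_near_0_of_holomorphic[of "min r s" "\<lambda>z. F z - G z"])
    show "(\<lambda>z. F z - G z) holomorphic_on ball 0 (min r s)"
      by (intro holomorphic_on_diff holomorphic_on_subset[OF F(2)] holomorphic_on_subset[OF G(2)]) auto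
    show "f x - g x = F (complex_of_real x) - G (complex_of_real x)" if "\<bar>x\<bar> < min r s" for x
      using that G(3)[of x] F(3)[of x] by simp
  qed (use F(1) G(1) in simp)
qed

lemma analytic_near_0_minus:
  assumes "analytic_near_0 f"
  shows "analytic_near_0 (\<lambda>x. - f x)"
proof -
  obtain r F where F: "r > 0" "F holomorphic_on ball 0 r"
    "\<And>x. \<bar>x\<bar> < r \<Longrightarrow> f x = F (complex_of_real x)"
    using analytic_near_0_holomorphicE[OF assms(1)] by blast
  show ?thesis
    by (rule analytic_near_0_of_holomorphic[OF F(1) holomorphic_on_minus[OF F(2)]]) (simp add: F(3))
qed

text \<open>The zeros of a nonzero holomorphic function are isolated.\<close>

lemma holomorphic_dichotomy:
  assumes "r > 0" and hol: "F holomorphic_on ball 0 r"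
  shows "(\<forall>z\<in>ball 0 r. F z = 0) \<or> (\<forall>\<^sub>F z in at 0. F z \<noteq> 0)"
proof (cases "F 0 = 0")
  case False
  have "isCont F 0"
    using holomorphic_on_imp_continuous_on[OF hol] \<open>r > 0\<close>
    by (simp add: continuous_on_eq_continuous_at)
  then have "\<forall>\<^sub>F z in at 0. F z \<noteq> 0"
    using False by (metis isContD tendsto_imp_eventually_ne)
  then show ?thesis ..
next
  case True
  show ?thesis
  proof (rule disjCI, rule ccontr)
    assume no: "\<not> (\<forall>\<^sub>F z in at 0. F z \<noteq> 0)" and "\<not> (\<forall>z\<in>ball 0 r. F z = 0)"
    then obtain b where "b \<in> ball 0 r" "F b \<noteq> 0" by blast
    then obtain e where "0 < e" "\<And>z. z \<in> ball 0 e - {0} \<Longrightarrow> F z \<noteq> 0"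
      using isolated_zeros[OF hol open_ball connected_ball _ True, of b] \<open>r > 0\<close>
      by (metis centre_in_ball)
    then have "\<forall>\<^sub>F z in at 0. F z \<noteq> 0"
      unfolding eventually_at by (intro exI[of _ e]) (simp add: dist_commute)
    with no show False ..
  qed
qed

lemma eventually_at_0_of_real:
  assumes "\<forall>\<^sub>F z in at (0::complex). P z"
  shows "\<forall>\<^sub>F x in at (0::real). P (complex_of_real x)"
proof -
  from assms obtain d where "d > 0" "\<And>z. z \<noteq> 0 \<Longrightarrow> dist z 0 < d \<Longrightarrow> P z"
    unfolding eventually_at by blast
  then show ?thesis
    unfolding eventually_at by (intro exI[of _ d]) simp
qed

lemma analytic_near_0_dichotomy:
  assumes "analytic_near_0 f"
  shows "(\<forall>\<^sub>F x in nhds 0. f x = 0) \<or> (\<forall>\<^sub>F x in at 0. f x \<noteq> 0)"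
proof -
  obtain r F where F: "r > 0" "F holomorphic_on ball 0 r"
    "\<And>x. \<bar>x\<bar> < r \<Longrightarrow> f x = F (complex_of_real x)"
    using analytic_near_0_holomorphicE[OF assms(1)] by blast
  have near: "\<forall>\<^sub>F x::real in nhds 0. \<bar>x\<bar> < r"
    using \<open>r > 0\<close> by (auto simp: eventually_nhds_metric dist_real_def)
  from holomorphic_dichotomy[OF F(1,2)] show ?thesis
  proof
    assume "\<forall>z\<in>ball 0 r. F z = 0"
    with near have "\<forall>\<^sub>F x in nhds 0. f x = 0"
      by (auto elim!: eventually_mono simp: F(3))
    then show ?thesis ..
  next
    assume "\<forall>\<^sub>F z in at 0. F z \<noteq> 0"
    have "\<forall>\<^sub>F x::real in at 0. \<bar>x\<bar> < r"
      using near by (simp add: eventually_at_filter eventually_mono)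
    with eventually_at_0_of_real[OF \<open>\<forall>\<^sub>F z in at 0. F z \<noteq> 0\<close>]
    have "\<forall>\<^sub>F x in at 0. f x \<noteq> 0"
      by eventually_elim (simp add: F(3))
    then show ?thesis ..
  qed
qed

lemma analytic_near_0_isCont:
  assumes "analytic_near_0 f"
  shows "isCont f 0"
proof -
  obtain r F where F: "r > 0" "F holomorphic_on ball 0 r"
    "\<And>x. \<bar>x\<bar> < r \<Longrightarrow> f x = F (complex_of_real x)"
    using analytic_near_0_holomorphicE[OF assms(1)] by blast
  have "isCont F (complex_of_real 0)"
    using holomorphic_on_imp_continuous_on[OF F(2)] F(1)
    by (simp add: continuous_on_eq_continuous_at)
  then have "isCont (\<lambda>x. F (complex_of_real x)) 0"
    by (intro isCont_o2[of 0 complex_of_real F]) auto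
  moreover have "\<forall>\<^sub>F x in nhds 0. F (complex_of_real x) = f x"
    using F(1,3) by (auto simp: eventually_nhds_metric dist_real_def intro!: exI[of _ r])
  ultimately show ?thesis by (simp add: isCont_cong)
qed

text \<open>Only even powers occur in the Taylor series of \<open>P\<close>, so \<open>P (csqrt w)\<close> is a power series in \<open>w\<close>; the branch cut of the square root is invisible.\<close>

lemma holomorphic_even_csqrt:
  fixes r :: real
  assumes "r > 0" and hol: "P holomorphic_on ball 0 r"
    and even: "\<And>z. norm z < r \<Longrightarrow> P (-z) = P z"
  shows "(\<lambda>w. P (csqrt w)) holomorphic_on ball 0 (r\<^sup>2)"
proof -
  define c where "c = (\<lambda>n. (deriv ^^ n) P 0 / fact n)"
  have s: "(\<lambda>n. c n * z ^ n) sums P z" if "norm z < r" for z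
    using holomorphic_power_series[OF hol, of z] that by (simp add: c_def)
  have "(\<lambda>n. c (2 * n) * w ^ n) sums P (csqrt w)" if "norm w < r\<^sup>2" for w
  proof -
    define z where "z = csqrt w"
    have z2: "z\<^sup>2 = w" by (simp add: z_def)
    have nz: "norm z < r"
      unfolding z_def using that \<open>r > 0\<close> by (simp add: real_less_lsqrt)
    have "(\<lambda>n. (c n * z ^ n + c n * (-z) ^ n) / 2) sums ((P z + P (-z)) / 2)"
      using s[of z] s[of "-z"] nz by (intro sums_divide sums_add) auto
    also have "(P z + P (-z)) / 2 = P z" using even[OF nz] by simp
    also have "(\<lambda>n. (c n * z ^ n + c n * (-z) ^ n) / 2) = (\<lambda>n. if even n then c n * z ^ n else 0)"
      by (auto simp: fun_eq_iff)
    finally have "(\<lambda>n. if even n then c n * z ^ n else 0) sums P z" .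
    then have "(\<lambda>n. (\<lambda>n. if even n then c n * z ^ n else 0) (2 * n)) sums P z"
      by (subst sums_mono_reindex) (auto simp: strict_mono_def elim!: evenE)
    then show ?thesis by (simp add: power_mult z2 z_def)
  qed
  then show ?thesis by (intro power_series_holomorphic[of 0 _ "\<lambda>n. c (2 * n)"]) auto
qed

section \<open>Separately holomorphic functions have double power series\<close>

lemma taylor_coeff_bound:
  assumes hol: "f holomorphic_on ball 0 R" and bd: "\<And>z. norm z < R \<Longrightarrow> norm (f z) \<le> M"
    and \<rho>: "0 < \<rho>" "\<rho> < R"
  shows "norm ((deriv ^^ n) f 0 / fact n) \<le> M / \<rho> ^ n"
proof -
  have "norm ((deriv ^^ n) f 0) \<le> fact n * M / \<rho> ^ n"
  proof (rule Cauchy_inequality)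
    show "f holomorphic_on ball 0 \<rho>"
      by (rule holomorphic_on_subset[OF hol]) (use \<rho> in auto)
    show "continuous_on (cball 0 \<rho>) f"
      by (rule continuous_on_subset[OF holomorphic_on_imp_continuous_on[OF hol]]) (use \<rho> in auto)
  qed (use \<rho> bd in auto)
  then show ?thesis by (simp add: norm_divide field_simps)
qed

text \<open>The constant does not depend on the series, only on the bound for its coefficients. Applied to a family of series this makes the convergence of the remainder quotient to the \<open>n\<close>-th coefficient uniform.\<close>

lemma geometric_tail_bound:
  fixes c :: "nat \<Rightarrow> complex"
  assumes s: "(\<lambda>i. c i * a ^ i) sums S" and cb: "\<And>i. norm (c i) \<le> M / \<rho> ^ i"
    and \<rho>: "0 < \<rho>" and a: "0 < norm a" "norm a \<le> \<rho> / 2"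
  shows "norm ((S - (\<Sum>i<n. c i * a ^ i)) / a ^ n - c n) \<le> norm a * (2 * M / \<rho> ^ Suc n)"
proof -
  have a0: "a \<noteq> 0" using a by auto
  have "(\<lambda>i. c (i + Suc n) * a ^ (i + Suc n)) sums (S - (\<Sum>i<Suc n. c i * a ^ i))"
    by (rule sums_split_initial_segment[OF s])
  then have "(\<lambda>i. c (i + Suc n) * a ^ (i + Suc n) / a ^ n) sums ((S - (\<Sum>i<Suc n. c i * a ^ i)) / a ^ n)"
    by (rule sums_divide)
  moreover have "(S - (\<Sum>i<Suc n. c i * a ^ i)) / a ^ n = (S - (\<Sum>i<n. c i * a ^ i)) / a ^ n - c n"
    using a0 by (simp add: field_simps)
  ultimately have s': "(\<lambda>i. c (i + Suc n) * a ^ (i + Suc n) / a ^ n) sums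
      ((S - (\<Sum>i<n. c i * a ^ i)) / a ^ n - c n)" by simp
  have geo: "(\<lambda>i. (norm a * M / \<rho> ^ Suc n) * (1/2) ^ i) sums ((norm a * M / \<rho> ^ Suc n) * 2)"
    using geometric_sums[of "1/2::real"] by (intro sums_mult) simp
  have "norm (c (i + Suc n) * a ^ (i + Suc n) / a ^ n) \<le> (norm a * M / \<rho> ^ Suc n) * (1/2) ^ i" for i
  proof -
    have M: "0 \<le> M" using order_trans[OF norm_ge_zero cb[of 0]] by simp
    have "norm (c (i + Suc n) * a ^ (i + Suc n) / a ^ n) = norm (c (i + Suc n)) * norm a * norm a ^ i"
      using a0 by (simp add: norm_mult norm_divide norm_power power_add)
    also have "\<dots> \<le> (M / \<rho> ^ (i + Suc n)) * norm a * (\<rho> / 2) ^ i"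
      proof (intro mult_mono cb power_mono)
      show "0 \<le> M / \<rho> ^ (i + Suc n)" "0 \<le> M / \<rho> ^ (i + Suc n) * norm a"
        using M \<rho> by simp_all
    qed (use a in simp_all)
    also have "\<dots> = (norm a * M / \<rho> ^ Suc n) * (1/2) ^ i"
      using \<rho> by (simp add: power_add power_divide field_simps)
    finally show ?thesis .
  qed
  from norm_sums_le[OF s' geo this] show ?thesis by (simp add: mult_ac)
qed

lemma summable_geometric_product:
  fixes x y :: real
  assumes "0 \<le> x" "x < 1" "0 \<le> y" "y < 1"
  shows "(\<lambda>(i, j). x ^ i * y ^ j) summable_on (UNIV :: (nat \<times> nat) set)"
proof -
  have s: "(\<lambda>i. z ^ i) summable_on (UNIV :: nat set)" if "0 \<le> z" "z < 1" for z :: real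
    using that by (subst summable_on_UNIV_nonneg_real_iff) (auto intro: summable_geometric)
  have "(\<lambda>(i, j). x ^ i * y ^ j) summable_on ((UNIV :: nat set) \<times> (UNIV :: nat set))"
  proof (rule summable_on_SigmaI[where g = "\<lambda>i. x ^ i * (\<Sum>\<^sub>\<infinity>j. y ^ j)"])
    show "((\<lambda>j. case (i, j) of (i, j) \<Rightarrow> x ^ i * y ^ j) has_sum x ^ i * (\<Sum>\<^sub>\<infinity>j. y ^ j)) UNIV" for i
      unfolding prod.case by (intro has_sum_cmult_right has_sum_infsum s assms)
    show "(\<lambda>i. x ^ i * (\<Sum>\<^sub>\<infinity>j. y ^ j)) summable_on UNIV"
      by (intro summable_on_cmult_left s assms)
  qed (use assms in auto)
  then show ?thesis by simp
qed

text \<open>Boundedness replaces joint continuity here: by Cauchy's inequality it makes the double Taylor series absolutely convergent without an appeal to iterated contour integrals.\<close>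

locale bounded_separately_holomorphic =
  fixes R M :: real and f :: "complex \<Rightarrow> complex \<Rightarrow> complex"
  assumes R_pos: "0 < R"
    and hol1: "\<And>b. norm b < R \<Longrightarrow> (\<lambda>a. f a b) holomorphic_on ball 0 R"
    and hol2: "\<And>a. norm a < R \<Longrightarrow> f a holomorphic_on ball 0 R"
    and bd: "\<And>a b. norm a < R \<Longrightarrow> norm b < R \<Longrightarrow> norm (f a b) \<le> M"
begin

definition taylor_fst :: "nat \<Rightarrow> complex \<Rightarrow> complex" where
  "taylor_fst i b = (deriv ^^ i) (\<lambda>a. f a b) 0 / fact i"

lemma taylor_fst_bound:
  assumes "0 < \<rho>" "\<rho> < R" "norm b < R"
  shows "norm (taylor_fst n b) \<le> M / \<rho> ^ n"
  unfolding taylor_fst_def by (rule taylor_coeff_bound[OF hol1]) (use assms bd in auto)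

lemma taylor_fst_sums:
  assumes "norm a < R" "norm b < R"
  shows "(\<lambda>i. taylor_fst i b * a ^ i) sums f a b"
  using holomorphic_power_series[OF hol1[OF assms(2)], of a] assms by (simp add: taylor_fst_def)

text \<open>The \<open>n\<close>-th coefficient is the limit of \<open>(f a b - (\<Sum>i<n. c\<^sub>i b * a ^ i)) / a ^ n\<close> as \<open>a\<close> tends to 0, uniformly in \<open>b\<close>; by induction these quotients are holomorphic in \<open>b\<close>, hence so is their limit.\<close>

lemma taylor_fst_holomorphic: "taylor_fst n holomorphic_on ball 0 R"
proof -
  define \<rho> where "\<rho> = R / 2"
  have \<rho>: "0 < \<rho>" "\<rho> < R" using R_pos by (auto simp: \<rho>_def)
  define s where "s m = complex_of_real (\<rho> / 2 / real (Suc m))" for m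
  have ns: "norm (s m) = \<rho> / 2 / real (Suc m)" for m
    unfolding s_def norm_of_real using \<rho> by simp
  have s: "0 < norm (s m)" "norm (s m) \<le> \<rho> / 2" for m
    using \<rho> by (auto simp: ns field_simps)
  have s0: "(\<lambda>m. norm (s m) * C) \<longlonglongrightarrow> 0" for C
    unfolding ns using LIMSEQ_inverse_real_of_nat[THEN tendsto_mult_left, of "\<rho> / 2 * C"]
    by (simp add: field_simps)
  show ?thesis
  proof (induction n rule: less_induct)
    case (less n)
    define g where "g m b = (f (s m) b - (\<Sum>i<n. taylor_fst i b * s m ^ i)) / s m ^ n" for m b
    have ulim: "uniform_limit (ball 0 R) g (taylor_fst n) sequentially"
    proof (rule uniform_limitI)
      fix e :: real assume "e > 0"
      have "\<forall>\<^sub>F m in sequentially. norm (s m) * (2 * M / \<rho> ^ Suc n) < e"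
        using order_tendstoD(2)[OF s0 \<open>e > 0\<close>] .
      then show "\<forall>\<^sub>F m in sequentially. \<forall>b\<in>ball 0 R. dist (g m b) (taylor_fst n b) < e"
      proof eventually_elim
        case (elim m)
        show ?case
        proof
          fix b :: complex assume "b \<in> ball 0 R"
          then have b: "norm b < R" by simp
          have "norm (s m) < R" using s(2)[of m] \<rho> by simp
          then have "norm (g m b - taylor_fst n b) \<le> norm (s m) * (2 * M / \<rho> ^ Suc n)"
            unfolding g_def
            by (intro geometric_tail_bound taylor_fst_sums taylor_fst_bound \<rho> s b)
          with elim show "dist (g m b) (taylor_fst n b) < e" by (simp add: dist_norm)
        qed
      qed
    qed
    show ?case
    proof (rule holomorphic_uniform_sequence[of _ g])
      show "g m holomorphic_on ball 0 R" for m
      proof -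
        have "norm (s m) < R" using s(2)[of m] \<rho> by simp
        moreover have "s m ^ n \<noteq> 0" using s(1)[of m] by auto
        ultimately show ?thesis
          unfolding g_def
          by (intro holomorphic_on_divide holomorphic_on_diff holomorphic_on_sum holomorphic_on_mult
              holomorphic_on_const hol2 less) simp_all
      qed
      show "\<exists>d>0. cball x d \<subseteq> ball 0 R \<and> uniform_limit (cball x d) g (taylor_fst n) sequentially"
        if x: "x \<in> ball 0 R" for x
      proof -
        obtain d where "d > 0" "cball x d \<subseteq> ball 0 R"
          using x open_contains_cball_eq[OF open_ball, of 0 R] by blast
        with uniform_limit_on_subset[OF ulim this(2)] show ?thesis by (intro exI[of _ d] conjI)
      qed
    qed simp
  qed
qed

text \<open>Applying Cauchy's inequality in each variable bounds the coefficients by \<open>M / \<rho> ^ (i + j)\<close> for every \<open>\<rho> < R\<close>, which dominates the double series by a product of two geometric series.\<close>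

lemma double_series:
  obtains c where "\<And>a b. norm a < R \<Longrightarrow> norm b < R \<Longrightarrow>
    ((\<lambda>(i, j). c i j * a ^ i * b ^ j) has_sum f a b) (UNIV :: (nat \<times> nat) set)"
proof (rule that)
  fix a b :: complex assume a: "norm a < R" and b: "norm b < R"
  let ?c = "\<lambda>i j. (deriv ^^ j) (taylor_fst i) 0 / fact j"
  define c where "c = ?c"
  obtain \<rho> where "max (norm a) (norm b) < \<rho>" "\<rho> < R"
    using dense[of "max (norm a) (norm b)" R] a b by auto
  then have \<rho>: "norm a < \<rho>" "norm b < \<rho>" "\<rho> < R" "0 < \<rho>"
    using norm_ge_zero[of a] by (simp_all del: norm_ge_zero)
  have M: "0 \<le> M" using bd[OF a b] norm_ge_zero[of "f a b"] by linarith
  have cb: "norm (c i j) \<le> M / \<rho> ^ i / \<rho> ^ j" for i j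
    unfolding c_def
    by (intro taylor_coeff_bound[OF taylor_fst_holomorphic] taylor_fst_bound) (use \<rho> in auto)
  have term_bound: "norm (c i j * a ^ i * b ^ j) \<le> M * ((norm a / \<rho>) ^ i * (norm b / \<rho>) ^ j)" for i j
  proof -
    have "norm (c i j * a ^ i * b ^ j) = norm (c i j) * norm a ^ i * norm b ^ j"
      by (simp add: norm_mult norm_power)
    also have "\<dots> \<le> (M / \<rho> ^ i / \<rho> ^ j) * norm a ^ i * norm b ^ j"
      by (intro mult_right_mono cb) auto
    also have "\<dots> = M * ((norm a / \<rho>) ^ i * (norm b / \<rho>) ^ j)"
      by (simp add: power_divide)
    finally show ?thesis .
  qed
  have "(\<lambda>(i, j). (norm a / \<rho>) ^ i * (norm b / \<rho>) ^ j) summable_on (UNIV :: (nat \<times> nat) set)"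
    by (rule summable_geometric_product) (use \<rho> in auto)
  then have "(\<lambda>p. M * (case p of (i, j) \<Rightarrow> (norm a / \<rho>) ^ i * (norm b / \<rho>) ^ j)) summable_on UNIV"
    by (rule summable_on_cmult_right)
  then have "(\<lambda>p. norm (case p of (i, j) \<Rightarrow> c i j * a ^ i * b ^ j)) summable_on UNIV"
    by (rule Infinite_Sum.abs_summable_on_comparison_test') (use term_bound in auto)
  then have summable: "(\<lambda>(i, j). c i j * a ^ i * b ^ j) summable_on (UNIV \<times> UNIV)"
    using Infinite_Sum.abs_summable_summable by simp
  have inner: "((\<lambda>j. c i j * a ^ i * b ^ j) has_sum taylor_fst i b * a ^ i) UNIV" for i
  proof (rule norm_summable_imp_has_sum)
    have "(\<lambda>j. c i j * b ^ j) sums taylor_fst i b"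
      using holomorphic_power_series[OF taylor_fst_holomorphic, of b] b by (simp add: c_def)
    from sums_mult2[OF this, of "a ^ i"]
    show "(\<lambda>j. c i j * a ^ i * b ^ j) sums (taylor_fst i b * a ^ i)" by (simp add: mult_ac)
    have "summable (\<lambda>j. M * (norm a / \<rho>) ^ i * (norm b / \<rho>) ^ j)"
      using \<rho> by (intro summable_mult summable_geometric) auto
    from summable_comparison_test'[OF this, of 0 "\<lambda>j. norm (c i j * a ^ i * b ^ j)"]
    show "summable (\<lambda>j. norm (c i j * a ^ i * b ^ j))"
      using term_bound[of i] by (simp add: mult.assoc)
  qed
  have outer: "((\<lambda>i. taylor_fst i b * a ^ i) has_sum f a b) UNIV"
  proof (rule norm_summable_imp_has_sum)
    show "(\<lambda>i. taylor_fst i b * a ^ i) sums f a b"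
      by (rule taylor_fst_sums[OF a b])
    have "norm (taylor_fst i b * a ^ i) \<le> M * (norm a / \<rho>) ^ i" for i
    proof -
      have "norm (taylor_fst i b * a ^ i) \<le> M / \<rho> ^ i * norm a ^ i"
        unfolding norm_mult norm_power
        by (intro mult_right_mono taylor_fst_bound) (use \<rho> b in auto)
      then show ?thesis by (simp add: power_divide)
    qed
    note le = this
    have "summable (\<lambda>i. M * (norm a / \<rho>) ^ i)"
      using \<rho> by (intro summable_mult summable_geometric) auto
    from summable_comparison_test'[OF this, of 0 "\<lambda>i. norm (taylor_fst i b * a ^ i)"] le
    show "summable (\<lambda>i. norm (taylor_fst i b * a ^ i))"
      by simp
  qed
  have "((\<lambda>(i, j). c i j * a ^ i * b ^ j) has_sum f a b) (UNIV \<times> UNIV)"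
    by (rule has_sum_SigmaI[OF _ outer summable]) (use inner in simp)
  then show "((\<lambda>(i, j). ?c i j * a ^ i * b ^ j) has_sum f a b) UNIV" by (simp add: c_def)
qed

text \<open>At a real point near the origin the double series is obtained from the function translated to that point, rather than by rearranging the series at the origin.\<close>

lemma analytic_near_00_of_real: "analytic_near_00 (\<lambda>x y. f (complex_of_real x) (complex_of_real y))"
  unfolding analytic_near_00_def
proof (intro exI[of _ "R / 2"] conjI allI impI)
  show "0 < R / 2" using R_pos by simp
  fix p q :: real assume pq: "\<bar>p\<bar> < R / 2 \<and> \<bar>q\<bar> < R / 2"
  define h where "h a b = f (complex_of_real p + a) (complex_of_real q + b)" for a b
  have less: "norm (complex_of_real p + a) < R" "norm (complex_of_real q + a) < R"
    if "norm a < R / 2" for a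
    using norm_triangle_ineq[of "complex_of_real p" a] norm_triangle_ineq[of "complex_of_real q" a] pq that
    by simp_all
  have comp: "(\<lambda>a. k (complex_of_real s + a)) holomorphic_on ball 0 (R / 2)"
    if "k holomorphic_on ball 0 R" "s = p \<or> s = q" for k s
  proof (rule holomorphic_on_compose_gen[of "\<lambda>a. complex_of_real s + a" _ k "ball 0 R", unfolded o_def])
    show "(\<lambda>a. complex_of_real s + a) ` ball 0 (R / 2) \<subseteq> ball 0 R"
      unfolding image_subset_iff using that(2) less by auto
  qed (use that in \<open>auto intro!: holomorphic_intros\<close>)
  obtain c where c: "\<And>a b. norm a < R / 2 \<Longrightarrow> norm b < R / 2 \<Longrightarrow>
      ((\<lambda>(i, j). c i j * a ^ i * b ^ j) has_sum h a b) (UNIV :: (nat \<times> nat) set)"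
  proof -
    interpret h: bounded_separately_holomorphic "R / 2" M h
    proof
      show "(\<lambda>a. h a b) holomorphic_on ball 0 (R / 2)" if "norm b < R / 2" for b
        unfolding h_def by (rule comp[OF hol1]) (use less that in auto)
      show "h a holomorphic_on ball 0 (R / 2)" if "norm a < R / 2" for a
        unfolding h_def by (rule comp[OF hol2]) (use less that in auto)
      show "norm (h a b) \<le> M" if "norm a < R / 2" "norm b < R / 2" for a b
        unfolding h_def by (rule bd) (use less that in auto)
    qed (use R_pos in auto)
    show thesis by (rule h.double_series) (rule that)
  qed
  show "\<exists>(a :: nat \<Rightarrow> nat \<Rightarrow> complex) \<rho>. \<rho> > 0 \<and>
         (\<forall>x y. \<bar>x - p\<bar> < \<rho> \<and> \<bar>y - q\<bar> < \<rho> \<longrightarrow>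
           ((\<lambda>(i, j). a i j * complex_of_real (x - p) ^ i * complex_of_real (y - q) ^ j)
              has_sum f (complex_of_real x) (complex_of_real y)) UNIV)"
  proof (intro exI[of _ c] exI[of _ "R / 2"] conjI allI impI)
    fix x y :: real assume "\<bar>x - p\<bar> < R / 2 \<and> \<bar>y - q\<bar> < R / 2"
    then show "((\<lambda>(i, j). c i j * complex_of_real (x - p) ^ i * complex_of_real (y - q) ^ j)
              has_sum f (complex_of_real x) (complex_of_real y)) UNIV"
      using c[of "complex_of_real (x - p)" "complex_of_real (y - q)"]
      unfolding h_def norm_of_real by simp
  qed (use R_pos in simp)
qed

end

section \<open>The square root as a product of inverse square roots of sinc\<close>

definition sinc :: "'a :: {real_normed_field, banach} \<Rightarrow> 'a" where
  "sinc z = (if z = 0 then 1 else sin z / z)"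

lemma sinc_0 [simp]: "sinc 0 = 1"
  by (simp add: sinc_def)

lemma sinc_minus [simp]: "sinc (- z) = sinc z"
  by (simp add: sinc_def)

lemma sinc_of_real: "sinc (complex_of_real x) = complex_of_real (sinc x)"
  by (simp add: sinc_def sin_of_real)

lemma holomorphic_on_sinc: "sinc holomorphic_on A"
proof -
  have "sinc holomorphic_on (UNIV :: complex set)"
  proof (rule pole_theorem_open_0[of sin UNIV 0])
    have "deriv sin (0::complex) = cos 0" by (rule DERIV_imp_deriv[OF DERIV_sin])
    then show "sinc 0 = deriv sin (0::complex)" by simp
  qed (auto simp: sinc_def intro: holomorphic_on_sin)
  then show ?thesis by (rule holomorphic_on_subset) simp
qed

lemma sinc_nonzero:
  fixes z :: complex
  assumes "norm z < pi"
  shows "sinc z \<noteq> 0"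
proof
  assume "sinc z = 0"
  then have "z \<noteq> 0" "sin z = 0" by (auto simp: sinc_def split: if_splits)
  then obtain n :: int where n: "z = complex_of_real (of_int n * pi)"
    by (auto simp: sin_eq_0)
  then have "\<bar>real_of_int n\<bar> * pi < 1 * pi"
    using assms by (simp add: norm_mult abs_mult)
  then have "\<bar>real_of_int n\<bar> < 1"
    by (subst (asm) mult_less_cancel_right_pos) auto
  then have "n = 0" by linarith
  with n \<open>z \<noteq> 0\<close> show False by simp
qed

lemma sinc_pos:
  fixes x :: real
  assumes "\<bar>x\<bar> < pi"
  shows "0 < sinc x"
proof -
  have "0 < sin y / y" if "0 < y" "y < pi" for y :: real
    using that by (intro divide_pos_pos sin_gt_zero)
  from this[of x] this[of "- x"] show ?thesis
    using assms by (cases "x = 0"; cases "x > 0") (auto simp: sinc_def)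
qed

lemma isCont_sinc: "isCont sinc (x::real)"
proof -
  have "isCont sinc (complex_of_real x)"
    using holomorphic_on_imp_continuous_on[OF holomorphic_on_sinc[of UNIV]]
    by (simp add: continuous_on_eq_continuous_at)
  then have "isCont (\<lambda>x. Re (sinc (complex_of_real x))) x"
    by (intro continuous_Re isCont_o2[of x complex_of_real sinc]) auto
  then show ?thesis by (simp add: sinc_of_real)
qed

text \<open>The root is taken of \<open>sinc (csqrt w)\<close>, a nonvanishing holomorphic function on the convex set \<open>ball 0 (pi\<^sup>2)\<close>, and then \<open>z\<^sup>2\<close> is substituted for \<open>w\<close>. In this way the evenness of \<open>F\<close> comes for free.\<close>

lemma inv_sqrt_sinc_exists:
  "\<exists>F. F holomorphic_on ball 0 pi \<and> F 0 = 1 \<and>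
     (\<forall>z\<in>ball 0 pi. F (- z) = F z \<and> (F z)\<^sup>2 * sinc z = (1::complex))"
proof -
  have "(\<lambda>w::complex. sinc (csqrt w)) holomorphic_on ball 0 (pi\<^sup>2)"
    by (rule holomorphic_even_csqrt) (auto intro: holomorphic_on_sinc)
  moreover have "norm (csqrt w) < pi" if "w \<in> ball 0 (pi\<^sup>2)" for w
    using that by (simp add: real_less_lsqrt)
  then have "sinc (csqrt w) \<noteq> 0" if "w \<in> ball 0 (pi\<^sup>2)" for w :: complex
    using that sinc_nonzero by blast
  moreover have "(0::complex) \<in> ball 0 (pi\<^sup>2)" by simp
  ultimately obtain g where g: "g holomorphic_on ball 0 (pi\<^sup>2)"
    "\<And>w. w \<in> ball 0 (pi\<^sup>2) \<Longrightarrow> exp (g w) = sinc (csqrt w)"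
    using holomorphic_logarithm_exists[OF convex_ball open_ball] by metis
  \<comment> \<open>Subtracting \<open>g 0\<close>, a logarithm of 1 that need not be 0, makes \<open>F 0 = 1\<close> and so fixes the sign of the root.\<close>
  define F where "F z = exp ((g 0 - g (z\<^sup>2)) / 2)" for z
  have sq: "z\<^sup>2 \<in> ball 0 (pi\<^sup>2)" if "z \<in> ball 0 pi" for z :: complex
    using that by (simp add: norm_power power_strict_mono)
  have "(g \<circ> (\<lambda>z. z\<^sup>2)) holomorphic_on ball 0 pi"
    by (rule holomorphic_on_compose_gen[OF _ g(1)]) (auto intro!: holomorphic_intros sq)
  then have "F holomorphic_on ball 0 pi"
    unfolding F_def o_def by (auto intro!: holomorphic_intros)
  moreover have "(F z)\<^sup>2 * sinc z = 1" if "z \<in> ball 0 pi" for z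
  proof -
    have "csqrt (z\<^sup>2) = z \<or> csqrt (z\<^sup>2) = - z"
      using power2_eq_iff[of "csqrt (z\<^sup>2)" z] by simp
    then have "exp (g (z\<^sup>2)) = sinc z"
      using g(2)[OF sq[OF that]] by auto
    moreover have "exp (g 0) = 1" using g(2)[of 0] by simp
    moreover have "(F z)\<^sup>2 = exp (g 0) / exp (g (z\<^sup>2))"
    proof -
      have "2 * ((g 0 - g (z\<^sup>2)) / 2) = g 0 - g (z\<^sup>2)" by simp
      then show ?thesis unfolding F_def exp_double[symmetric] exp_diff[symmetric] by (rule arg_cong)
    qed
    moreover have "sinc z \<noteq> 0" using that by (intro sinc_nonzero) simp
    ultimately show ?thesis by simp
  qed
  ultimately show ?thesis by (intro exI[of _ F]) (auto simp: F_def)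
qed

definition inv_sqrt_sinc :: "complex \<Rightarrow> complex" where
  "inv_sqrt_sinc = (SOME F. F holomorphic_on ball 0 pi \<and> F 0 = 1 \<and>
     (\<forall>z\<in>ball 0 pi. F (- z) = F z \<and> (F z)\<^sup>2 * sinc z = 1))"

lemma
  shows inv_sqrt_sinc_holomorphic: "inv_sqrt_sinc holomorphic_on ball 0 pi"
    and inv_sqrt_sinc_0: "inv_sqrt_sinc 0 = 1"
    and inv_sqrt_sinc_minus: "norm z < pi \<Longrightarrow> inv_sqrt_sinc (- z) = inv_sqrt_sinc z"
    and inv_sqrt_sinc_square: "norm z < pi \<Longrightarrow> (inv_sqrt_sinc z)\<^sup>2 * sinc z = 1"
  using someI_ex[OF inv_sqrt_sinc_exists, folded inv_sqrt_sinc_def] by auto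

text \<open>On the reals the square of the function is positive, so its values are real and nonzero; they start at 1 and can never change sign.\<close>

lemma inv_sqrt_sinc_of_real_nonneg:
  assumes "0 \<le> x" "x < pi"
  shows "inv_sqrt_sinc (complex_of_real x) = complex_of_real (1 / sqrt (sinc x))"
proof -
  define h where "h y = inv_sqrt_sinc (complex_of_real y)" for y
  have sq: "(h y)\<^sup>2 = complex_of_real (1 / sinc y)" and pos: "0 < sinc y" if "0 \<le> y" "y \<le> x" for y
  proof -
    show "0 < sinc y" using that assms by (intro sinc_pos) auto
    with inv_sqrt_sinc_square[of "complex_of_real y"] that assms
    show "(h y)\<^sup>2 = complex_of_real (1 / sinc y)"
      by (simp add: h_def sinc_of_real field_simps)
  qed
  have parts: "(Re (h y))\<^sup>2 - (Im (h y))\<^sup>2 = 1 / sinc y" "Re (h y) * Im (h y) = 0"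
    if "0 \<le> y" "y \<le> x" for y
    using sq[OF that] by (simp_all add: complex_eq_iff Re_power2 Im_power2)
  have "continuous_on {0..x} (\<lambda>y. Re (h y))"
    unfolding h_def
    by (intro continuous_on_Re continuous_on_compose2[OF holomorphic_on_imp_continuous_on[OF inv_sqrt_sinc_holomorphic]]
        continuous_intros) (use assms in auto)
  moreover have "Re (h 0) = 1" by (simp add: h_def inv_sqrt_sinc_0)
  ultimately have "0 < Re (h x)"
  proof (rule_tac ccontr)
    assume "continuous_on {0..x} (\<lambda>y. Re (h y))" "Re (h 0) = 1" "\<not> 0 < Re (h x)"
    then obtain y where y: "0 \<le> y" "y \<le> x" "Re (h y) = 0"
      using IVT2'[of "\<lambda>y. Re (h y)" x 0 0] assms(1) by auto
    have "0 < 1 / sinc y" using pos[OF y(1,2)] by simp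
    moreover have "1 / sinc y \<le> 0" using parts(1)[OF y(1,2)] y(3)
      by (metis diff_0 neg_le_0_iff_le power_zero_numeral zero_le_power2 power2_eq_square mult_zero_left)
    ultimately show False by simp
  qed
  moreover from this have "Im (h x) = 0" using parts(2)[of x] assms by simp
  moreover from this have "Re (h x) = sqrt (1 / sinc x)"
    using parts(1)[of x] assms \<open>0 < Re (h x)\<close> by (intro real_sqrt_unique[symmetric]) auto
  ultimately show ?thesis by (simp add: complex_eq_iff h_def real_sqrt_divide)
qed

lemma inv_sqrt_sinc_of_real:
  assumes "\<bar>x\<bar> < pi"
  shows "inv_sqrt_sinc (complex_of_real x) = complex_of_real (1 / sqrt (sinc x))"
proof (cases "0 \<le> x")
  case True
  with assms show ?thesis by (intro inv_sqrt_sinc_of_real_nonneg) auto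
next
  case False
  have "inv_sqrt_sinc (complex_of_real x) = inv_sqrt_sinc (complex_of_real (- x))"
    using inv_sqrt_sinc_minus[of "complex_of_real x"] assms by simp
  also have "\<dots> = complex_of_real (1 / sqrt (sinc (- x)))"
    using False assms by (intro inv_sqrt_sinc_of_real_nonneg) auto
  finally show ?thesis by simp
qed

lemma abs_arctan_less: "\<bar>arctan x\<bar> < pi / 2"
  using arctan_bounded[of x] by auto

text \<open>The heart of the proof. With \<open>x = tan s\<close> both factors of \<open>tan\<^sup>2 t - x\<^sup>2\<close> are sines divided by \<open>cos t cos s\<close>, and each of them is matched by a factor of \<open>t\<^sup>2 - s\<^sup>2\<close>.\<close>

lemma midpoint_quotient:
  assumes t: "\<bar>t\<bar> < pi / 2" and ne: "(tan t)\<^sup>2 \<noteq> x\<^sup>2"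
  defines "s \<equiv> arctan x"
  shows "(t\<^sup>2 - s\<^sup>2) / ((tan t)\<^sup>2 - x\<^sup>2) = (cos t * cos s)\<^sup>2 / (sinc (t - s) * sinc (t + s))"
proof -
  have x: "x = tan s" by (simp add: s_def tan_arctan)
  have s: "\<bar>s\<bar> < pi / 2" unfolding s_def by (rule abs_arctan_less)
  have "0 < cos t" "0 < cos s" using t s by (auto intro!: cos_gt_zero_pi)
  then have c: "cos t \<noteq> 0" "cos s \<noteq> 0" by simp_all
  have ts: "t \<noteq> s" "t \<noteq> - s" using ne x by auto
  have pos: "0 < sinc (t - s)" "0 < sinc (t + s)"
    using t s by (auto intro!: sinc_pos)
  have sums: "tan t + tan s = sin (t + s) / (cos t * cos s)"
    "tan t - tan s = sin (t - s) / (cos t * cos s)"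
    using add_tan_eq[of t s] add_tan_eq[of t "- s"] c by simp_all
  have sin: "sin (t - s) = sinc (t - s) * (t - s)" "sin (t + s) = sinc (t + s) * (t + s)"
    using ts by (auto simp: sinc_def add_eq_0_iff)
  have "(tan t)\<^sup>2 - x\<^sup>2 = (tan t + tan s) * (tan t - tan s)"
    unfolding x by (simp add: power2_eq_square algebra_simps)
  also have "\<dots> = (sinc (t - s) * sinc (t + s)) * (t\<^sup>2 - s\<^sup>2) / (cos t * cos s)\<^sup>2"
    unfolding sums sin by (simp add: power2_eq_square algebra_simps)
  finally have eq: "(tan t)\<^sup>2 - x\<^sup>2 = (sinc (t - s) * sinc (t + s)) * (t\<^sup>2 - s\<^sup>2) / (cos t * cos s)\<^sup>2" .
  have "t\<^sup>2 - s\<^sup>2 \<noteq> 0" using ts by (auto simp: power2_eq_iff)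
  then show ?thesis unfolding eq using pos c by (simp add: field_simps)
qed

text \<open>The part of \<open>\<phi>\<close> that is symmetric in \<open>t\<close> and \<open>s = arctan x\<close>. Unlike the quotient it comes from, it is defined and smooth on \<open>t = \<plusminus> s\<close>.\<close>

definition mid_kernel :: "real \<Rightarrow> real \<Rightarrow> complex" where
  "mid_kernel t s = inv_sqrt_sinc (complex_of_real (t - s)) * inv_sqrt_sinc (complex_of_real (t + s))"

lemma mid_kernel_real:
  assumes "\<bar>t\<bar> < pi / 2" "\<bar>s\<bar> < pi / 2"
  shows "mid_kernel t s = complex_of_real (1 / sqrt (sinc (t - s) * sinc (t + s)))"
  using assms unfolding mid_kernel_def by (subst (1 2) inv_sqrt_sinc_of_real) (auto simp: real_sqrt_mult)

lemma csqrt_midpoint_quotient: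
  assumes t: "\<bar>t\<bar> < pi / 2" and ne: "(tan t)\<^sup>2 \<noteq> x\<^sup>2"
  shows "csqrt ((complex_of_real (t\<^sup>2) - (complex_of_real (arctan x))\<^sup>2) / complex_of_real ((tan t)\<^sup>2 - x\<^sup>2)) =
     complex_of_real (cos t * cos (arctan x)) * mid_kernel t (arctan x)"
proof -
  define s where "s = arctan x"
  have s: "\<bar>s\<bar> < pi / 2" unfolding s_def by (rule abs_arctan_less)
  have pos: "0 < sinc (t - s)" "0 < sinc (t + s)"
    using t s by (auto intro!: sinc_pos)
  have c: "0 < cos t" "0 < cos s"
    using t s by (auto intro!: cos_gt_zero_pi)
  have "(complex_of_real (t\<^sup>2) - (complex_of_real s)\<^sup>2) / complex_of_real ((tan t)\<^sup>2 - x\<^sup>2) =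
      complex_of_real ((t\<^sup>2 - s\<^sup>2) / ((tan t)\<^sup>2 - x\<^sup>2))" by simp
  also have "\<dots> = complex_of_real ((cos t * cos s)\<^sup>2 / (sinc (t - s) * sinc (t + s)))"
    using midpoint_quotient[OF t ne] by (simp add: s_def)
  also have "csqrt \<dots> = complex_of_real (sqrt ((cos t * cos s)\<^sup>2 / (sinc (t - s) * sinc (t + s))))"
    using pos by (subst csqrt_of_real_nonneg) auto
  also have "sqrt ((cos t * cos s)\<^sup>2 / (sinc (t - s) * sinc (t + s))) =
      (cos t * cos s) * (1 / sqrt (sinc (t - s) * sinc (t + s)))"
    using c by (simp add: real_sqrt_divide real_sqrt_abs)
  finally show ?thesis
    unfolding s_def[symmetric] mid_kernel_real[OF t s] of_real_mult .
qed

lemma arctan_quot_cos: "arctan_quot x * cos (arctan x) = sinc (arctan x)"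
proof -
  have "x * cos (arctan x) = sin (arctan x)"
    using tan_arctan[of x] cos_arctan_not_zero[of x] by (metis tan_def nonzero_divide_eq_eq)
  then show ?thesis by (simp add: arctan_quot_def sinc_def)
qed

lemma phi_formula_alt:
  assumes "\<bar>t\<bar> < pi / 2"
  shows "arctan_quot x / cos t * sqrt ((t\<^sup>2 - (arctan x)\<^sup>2) / ((tan t)\<^sup>2 - x\<^sup>2)) = phi_formula t x"
proof -
  have c: "0 < cos t" using assms by (intro cos_gt_zero_pi) auto
  have "sqrt (1 + (tan t)\<^sup>2) = 1 / cos t"
    using c by (simp add: tan_sec real_sqrt_abs inverse_eq_divide)
  moreover have "phi_formula t x = arctan_quot x *
      (sqrt (1 + (tan t)\<^sup>2) * sqrt ((t\<^sup>2 - (arctan x)\<^sup>2) / ((tan t)\<^sup>2 - x\<^sup>2)))"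
    unfolding phi_formula_def real_sqrt_mult[symmetric] by simp
  ultimately show ?thesis by simp
qed

text \<open>The closed form of \<open>\<phi>(t\<^sup>2, tan\<^sup>2 s)\<close> for the canonical \<open>\<theta>\<close> and \<open>\<psi>\<close>, without removable singularities.\<close>

definition mid_symbol :: "real \<Rightarrow> real \<Rightarrow> real" where
  "mid_symbol t s = sinc s / sqrt (sinc (t - s) * sinc (t + s))"

lemma phi_formula_eq:
  assumes t: "\<bar>t\<bar> < pi / 2" and ne: "(tan t)\<^sup>2 \<noteq> x\<^sup>2"
  shows "phi_formula t x = mid_symbol t (arctan x)"
proof -
  define s where "s = arctan x"
  have s: "\<bar>s\<bar> < pi / 2" unfolding s_def by (rule abs_arctan_less)
  have c: "0 < cos t" "0 < cos s"
    using t s by (auto intro!: cos_gt_zero_pi)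
  have "phi_formula t x = arctan_quot x / cos t * sqrt ((cos t * cos s)\<^sup>2 / (sinc (t - s) * sinc (t + s)))"
    using phi_formula_alt[OF t, of x] midpoint_quotient[OF t ne] by (simp add: s_def)
  also have "\<dots> = (arctan_quot x * cos s) / sqrt (sinc (t - s) * sinc (t + s))"
    using c by (simp add: real_sqrt_divide real_sqrt_abs)
  finally show ?thesis by (simp add: s_def arctan_quot_cos mid_symbol_def)
qed

text \<open>For \<open>\<bar>u\<bar> < pi / 2\<close> the equation \<open>tan\<^sup>2 u = x\<^sup>2\<close> has only the solutions \<open>u = \<plusminus> arctan x\<close>.\<close>

lemma eventually_off_diagonal:
  assumes t: "\<bar>t\<bar> < pi / 2"
  shows "\<forall>\<^sub>F u in at t. \<bar>u\<bar> < pi / 2 \<and> (tan u)\<^sup>2 \<noteq> x\<^sup>2"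
proof -
  have "\<forall>\<^sub>F u in at t. u \<noteq> arctan x \<and> u \<noteq> - arctan x"
    by (intro eventually_conj eventually_neq_at_within)
  moreover have "\<forall>\<^sub>F u in at t. \<bar>u\<bar> < pi / 2"
    using t by (intro order_tendstoD(2)[OF tendsto_rabs[OF tendsto_ident_at]]) 
  ultimately show ?thesis
  proof eventually_elim
    case (elim u)
    have "arctan (tan u) = u" using elim by (intro arctan_tan) auto
    then have "tan u \<noteq> x" "tan u \<noteq> - x" using elim by (auto simp: arctan_minus)
    with elim show ?case by (auto simp: power2_eq_iff)
  qed
qed

lemma isCont_mid_symbol:
  assumes "\<bar>t\<bar> < pi / 2" "\<bar>s\<bar> < pi / 2"
  shows "isCont (\<lambda>t. mid_symbol t s) t"
proof -
  have "0 < sinc (t - s) * sinc (t + s)"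
    using assms by (intro mult_pos_pos sinc_pos) auto
  then show ?thesis
    unfolding mid_symbol_def
    by (intro continuous_intros isCont_o2[OF _ isCont_sinc]) auto
qed

lemma phi_mid_eq:
  assumes t: "\<bar>t\<bar> < pi / 2"
  shows "phi_mid t x = mid_symbol t (arctan x)"
proof (cases "(tan t)\<^sup>2 = x\<^sup>2")
  case False
  then show ?thesis using phi_formula_eq[OF t] by (simp add: phi_mid_def)
next
  case True
  have "((\<lambda>u. mid_symbol u (arctan x)) \<longlongrightarrow> mid_symbol t (arctan x)) (at t)"
    using isCont_mid_symbol[OF t abs_arctan_less] by (simp add: isCont_def)
  moreover have "\<forall>\<^sub>F u in at t. phi_formula u x = mid_symbol u (arctan x)"
    using eventually_off_diagonal[OF t, of x] by eventually_elim (simp add: phi_formula_eq)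
  ultimately have "((\<lambda>u. phi_formula u x) \<longlongrightarrow> mid_symbol t (arctan x)) (at t)"
    by (simp add: tendsto_cong)
  then show ?thesis using True by (simp add: phi_mid_def tendsto_Lim)
qed

section \<open>Analytic functions of two real variables near the origin\<close>

lemma eventually_nhds_00:
  "(\<forall>\<^sub>F (t, x) in nhds (0::real, 0::real). P t x) \<longleftrightarrow>
     (\<exists>d>0. \<forall>t x. \<bar>t\<bar> < d \<and> \<bar>x\<bar> < d \<longrightarrow> P t x)" (is "?L \<longleftrightarrow> ?R")
proof
  assume ?L
  then obtain d where d: "d > 0" "\<And>t x. dist (t, x) (0, 0) < d \<Longrightarrow> P t x"
    by (auto simp: eventually_nhds_metric)
  have "P t x" if "\<bar>t\<bar> < d / 2" "\<bar>x\<bar> < d / 2" for t x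
  proof (rule d(2))
    have "dist (t, x) (0, 0) \<le> \<bar>t\<bar> + \<bar>x\<bar>"
      by (simp add: dist_Pair_Pair sqrt_sum_squares_le_sum_abs)
    with that show "dist (t, x) (0, 0) < d" by simp
  qed
  with d(1) show ?R by (intro exI[of _ "d / 2"]) auto
next
  assume ?R
  then obtain d where d: "d > 0" "\<And>t x. \<bar>t\<bar> < d \<Longrightarrow> \<bar>x\<bar> < d \<Longrightarrow> P t x" by blast
  have "P t x" if "dist (t, x) (0, 0) < d" for t x
  proof (rule d(2))
    have "sqrt (\<bar>t\<bar>\<^sup>2 + \<bar>x\<bar>\<^sup>2) < d" using that by (simp add: dist_Pair_Pair)
    then show "\<bar>t\<bar> < d" "\<bar>x\<bar> < d"
      by (auto intro: le_less_trans[OF real_sqrt_sum_squares_ge1] le_less_trans[OF real_sqrt_sum_squares_ge2]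
          simp del: power2_abs)
  qed
  with d(1) show ?L by (auto simp: eventually_nhds_metric)
qed

lemma eventually_nhds_0:
  "(\<forall>\<^sub>F x in nhds (0::real). P x) \<longleftrightarrow> (\<exists>d>0. \<forall>x. \<bar>x\<bar> < d \<longrightarrow> P x)"
  by (auto simp: eventually_nhds_metric dist_real_def)

lemma analytic_near_0_const: "analytic_near_0 (\<lambda>x. c)"
  by (rule analytic_near_0_of_holomorphic[of 1 "\<lambda>z. c"]) auto

lemma analytic_near_0_eq_zero:
  assumes "analytic_near_0 f" "\<exists>\<^sub>F x in at 0. f x = 0"
  shows "\<forall>\<^sub>F x in nhds 0. f x = 0"
  using analytic_near_0_dichotomy[OF assms(1)] assms(2) by (auto simp: frequently_def)

text \<open>At the centre of a double power series, setting one variable to its central value leaves only the terms of order 0 in that variable.\<close>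

lemma analytic_near_00_sections:
  assumes "analytic_near_00 \<phi>"
  obtains r where "r > 0"
    "\<And>p q. \<bar>p\<bar> < r \<Longrightarrow> \<bar>q\<bar> < r \<Longrightarrow> analytic_near_0 (\<lambda>u. \<phi> (p + u) q)"
    "\<And>p q. \<bar>p\<bar> < r \<Longrightarrow> \<bar>q\<bar> < r \<Longrightarrow> analytic_near_0 (\<lambda>u. \<phi> p (q + u))"
proof -
  obtain r :: real where r: "r > 0" and ser: "\<And>p q. \<bar>p\<bar> < r \<Longrightarrow> \<bar>q\<bar> < r \<Longrightarrow>
       (\<exists>(a :: nat \<Rightarrow> nat \<Rightarrow> complex) \<rho>. \<rho> > 0 \<and>
         (\<forall>x y. \<bar>x - p\<bar> < \<rho> \<and> \<bar>y - q\<bar> < \<rho> \<longrightarrow>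
           ((\<lambda>(i, j). a i j * complex_of_real (x - p) ^ i * complex_of_real (y - q) ^ j)
              has_sum \<phi> x y) UNIV))"
    using assms unfolding analytic_near_00_def by blast
  have first: "\<exists>(a :: nat \<Rightarrow> complex) \<rho>. \<rho> > 0 \<and>
      (\<forall>x. \<bar>x - p\<bar> < \<rho> \<longrightarrow> (\<lambda>n. a n * complex_of_real (x - p) ^ n) sums \<phi> x q)"
    and second: "\<exists>(a :: nat \<Rightarrow> complex) \<rho>. \<rho> > 0 \<and>
      (\<forall>y. \<bar>y - q\<bar> < \<rho> \<longrightarrow> (\<lambda>n. a n * complex_of_real (y - q) ^ n) sums \<phi> p y)"
    if pq: "\<bar>p\<bar> < r" "\<bar>q\<bar> < r" for p q
  proof -
    obtain a :: "nat \<Rightarrow> nat \<Rightarrow> complex" and \<rho> where \<rho>: "\<rho> > 0"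
      and S: "\<And>x y. \<bar>x - p\<bar> < \<rho> \<Longrightarrow> \<bar>y - q\<bar> < \<rho> \<Longrightarrow>
        ((\<lambda>(i, j). a i j * complex_of_real (x - p) ^ i * complex_of_real (y - q) ^ j) has_sum \<phi> x y) UNIV"
      using ser[OF pq] by blast
    have "(\<lambda>n. a n 0 * complex_of_real (x - p) ^ n) sums \<phi> x q" if "\<bar>x - p\<bar> < \<rho>" for x
    proof -
      have "((\<lambda>(i, j). a i j * complex_of_real (x - p) ^ i * complex_of_real (q - q) ^ j) has_sum \<phi> x q) UNIV"
        using that \<rho> by (intro S) auto
      also have "?this \<longleftrightarrow> ((\<lambda>(i, j). a i j * complex_of_real (x - p) ^ i) has_sum \<phi> x q) (range (\<lambda>i. (i, 0)))"
        by (rule has_sum_cong_neutral) auto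
      also have "\<dots> \<longleftrightarrow> ((\<lambda>i. a i 0 * complex_of_real (x - p) ^ i) has_sum \<phi> x q) UNIV"
        by (subst has_sum_reindex) (auto simp: inj_on_def o_def)
      finally show ?thesis by (rule has_sum_imp_sums)
    qed
    with \<rho> show "\<exists>(a :: nat \<Rightarrow> complex) \<rho>. \<rho> > 0 \<and>
      (\<forall>x. \<bar>x - p\<bar> < \<rho> \<longrightarrow> (\<lambda>n. a n * complex_of_real (x - p) ^ n) sums \<phi> x q)"
      by (intro exI[of _ "\<lambda>n. a n 0"] exI[of _ \<rho>]) simp
    have "(\<lambda>n. a 0 n * complex_of_real (y - q) ^ n) sums \<phi> p y" if "\<bar>y - q\<bar> < \<rho>" for y
    proof -
      have "((\<lambda>(i, j). a i j * complex_of_real (p - p) ^ i * complex_of_real (y - q) ^ j) has_sum \<phi> p y) UNIV"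
        using that \<rho> by (intro S) auto
      also have "?this \<longleftrightarrow> ((\<lambda>(i, j). a i j * complex_of_real (y - q) ^ j) has_sum \<phi> p y) (range (\<lambda>j. (0, j)))"
        by (rule has_sum_cong_neutral) auto
      also have "\<dots> \<longleftrightarrow> ((\<lambda>j. a 0 j * complex_of_real (y - q) ^ j) has_sum \<phi> p y) UNIV"
        by (subst has_sum_reindex) (auto simp: inj_on_def o_def)
      finally show ?thesis by (rule has_sum_imp_sums)
    qed
    with \<rho> show "\<exists>(a :: nat \<Rightarrow> complex) \<rho>. \<rho> > 0 \<and>
      (\<forall>y. \<bar>y - q\<bar> < \<rho> \<longrightarrow> (\<lambda>n. a n * complex_of_real (y - q) ^ n) sums \<phi> p y)"
      by (intro exI[of _ "\<lambda>n. a 0 n"] exI[of _ \<rho>]) simp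
  qed
  have shift: "analytic_near_0 (\<lambda>u. g (p + u))"
    if p: "\<bar>p\<bar> < r" and g: "\<And>p. \<bar>p\<bar> < r \<Longrightarrow> \<exists>(a :: nat \<Rightarrow> complex) \<rho>. \<rho> > 0 \<and>
      (\<forall>x. \<bar>x - p\<bar> < \<rho> \<longrightarrow> (\<lambda>n. a n * complex_of_real (x - p) ^ n) sums g x)" for p g
    unfolding analytic_near_0_def
  proof (intro exI[of _ "r - \<bar>p\<bar>"] conjI allI impI)
    fix p' assume "\<bar>p'\<bar> < r - \<bar>p\<bar>"
    then have "\<bar>p + p'\<bar> < r" by linarith
    from g[OF this] obtain a :: "nat \<Rightarrow> complex" and \<rho> where "\<rho> > 0"
      and S: "\<And>x. \<bar>x - (p + p')\<bar> < \<rho> \<Longrightarrow> (\<lambda>n. a n * complex_of_real (x - (p + p')) ^ n) sums g x" by blast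
    have "(\<lambda>n. a n * complex_of_real (u - p') ^ n) sums g (p + u)" if "\<bar>u - p'\<bar> < \<rho>" for u
    proof -
      have "p + u - (p + p') = u - p'" by simp
      with S[of "p + u"] that show ?thesis by simp
    qed
    with \<open>\<rho> > 0\<close> show "\<exists>(a :: nat \<Rightarrow> complex) \<rho>. \<rho> > 0 \<and>
         (\<forall>x. \<bar>x - p'\<bar> < \<rho> \<longrightarrow> (\<lambda>n. a n * complex_of_real (x - p') ^ n) sums g (p + x))" by blast
  qed (use p in simp)
  show thesis
  proof (rule that[OF r])
    show "analytic_near_0 (\<lambda>u. \<phi> (p + u) q)" if "\<bar>p\<bar> < r" "\<bar>q\<bar> < r" for p q
      using that by (intro shift[of p "\<lambda>x. \<phi> x q"] first)
    show "analytic_near_0 (\<lambda>u. \<phi> p (q + u))" if "\<bar>p\<bar> < r" "\<bar>q\<bar> < r" for p q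
      using that by (intro shift[of q "\<phi> p"] second)
  qed
qed

text \<open>Continuity in the first argument alone suffices below: exceptional points are always approached by varying \<open>t\<close> with \<open>x\<close> fixed.\<close>

lemma analytic_near_00_isCont:
  assumes "analytic_near_00 \<phi>"
  obtains r where "r > 0" "\<And>p q. \<bar>p\<bar> < r \<Longrightarrow> \<bar>q\<bar> < r \<Longrightarrow> isCont (\<lambda>x. \<phi> x q) p"
proof -
  obtain r where r: "r > 0" and S: "\<And>p q. \<bar>p\<bar> < r \<Longrightarrow> \<bar>q\<bar> < r \<Longrightarrow> analytic_near_0 (\<lambda>u. \<phi> (p + u) q)"
    by (rule analytic_near_00_sections[OF assms]) (rule that)
  show thesis
  proof (rule that[OF r])
    fix p q :: real assume "\<bar>p\<bar> < r" "\<bar>q\<bar> < r"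
    then have "isCont (\<lambda>u. \<phi> (p + u) q) 0" by (intro analytic_near_0_isCont S)
    then have "isCont (\<lambda>x. \<phi> (p + (x - p)) q) p"
      by (intro isCont_o2[of p "\<lambda>x. x - p" "\<lambda>u. \<phi> (p + u) q"]) (auto intro!: continuous_intros)
    then show "isCont (\<lambda>x. \<phi> x q) p" by simp
  qed
qed

text \<open>This is how identities that hold where the denominator is nonzero are carried over to its zeros.\<close>

lemma off_diagonal_extend:
  fixes f g :: "real \<Rightarrow> complex"
  assumes t: "\<bar>t\<bar> < pi / 2" and "isCont f t" "isCont g t"
    and eq: "\<forall>\<^sub>F u in nhds t. (tan u)\<^sup>2 \<noteq> x\<^sup>2 \<longrightarrow> f u = g u"
  shows "f t = g t"
proof (rule tendsto_unique[of "at t" g])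
  have "\<forall>\<^sub>F u in at t. (tan u)\<^sup>2 \<noteq> x\<^sup>2 \<longrightarrow> f u = g u"
    using eq by (auto simp: eventually_at_filter elim: eventually_mono)
  with eventually_off_diagonal[OF t, of x] have "\<forall>\<^sub>F u in at t. f u = g u"
    by eventually_elim simp
  moreover have "(f \<longlongrightarrow> f t) (at t)" using assms by (simp add: isCont_def)
  ultimately show "(g \<longlongrightarrow> f t) (at t)" by (simp add: tendsto_cong)
  show "(g \<longlongrightarrow> g t) (at t)" using assms by (simp add: isCont_def)
qed simp

lemma eventually_nhds_abs_less:
  fixes t :: real
  assumes "\<bar>t\<bar> < d"
  shows "\<forall>\<^sub>F u in nhds t. \<bar>u\<bar> < d"
  using assms by (intro order_tendstoD(2)[OF tendsto_rabs[OF filterlim_ident]])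

lemma square_abs_less: "\<bar>t\<bar> < 1 \<Longrightarrow> \<bar>t\<bar> < r \<Longrightarrow> \<bar>t\<^sup>2\<bar> < (r::real)"
  using mult_left_le_one_le[of "\<bar>t\<bar>" "\<bar>t\<bar>"] by (simp add: power2_eq_square abs_mult)

text \<open>Away from the zeros of the denominator the identity is the square of the formula for \<open>\<phi>\<close>, for whichever branch of the root; both sides are continuous in \<open>t\<close>.\<close>

lemma defining_identity:
  assumes an: "analytic_near_00 \<phi>" and def: "defines_phi \<theta> \<psi> \<phi>"
  shows "\<forall>\<^sub>F (t, x) in nhds (0, 0).
         complex_of_real ((cos t)\<^sup>2 * ((tan t)\<^sup>2 - x\<^sup>2)) * (\<phi> (t\<^sup>2) (x\<^sup>2))\<^sup>2 =
         (\<psi> x)\<^sup>2 * (complex_of_real (t\<^sup>2) - (\<theta> x)\<^sup>2)"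
proof -
  obtain r where r: "r > 0" and cont: "\<And>p q. \<bar>p\<bar> < r \<Longrightarrow> \<bar>q\<bar> < r \<Longrightarrow> isCont (\<lambda>x. \<phi> x q) p"
    by (rule analytic_near_00_isCont[OF an]) (rule that)
  obtain d where d: "d > 0" and eq: "\<And>t x. \<bar>t\<bar> < d \<Longrightarrow> \<bar>x\<bar> < d \<Longrightarrow> (tan t)\<^sup>2 \<noteq> x\<^sup>2 \<Longrightarrow>
        \<phi> (t\<^sup>2) (x\<^sup>2) = \<psi> x / complex_of_real (cos t) *
          csqrt ((complex_of_real (t\<^sup>2) - (\<theta> x)\<^sup>2) / complex_of_real ((tan t)\<^sup>2 - x\<^sup>2))"
    using def unfolding defines_phi_def eventually_nhds_00 by blast
  define e where "e = min d (min r 1)"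
  let ?L = "\<lambda>x t. complex_of_real ((cos t)\<^sup>2 * ((tan t)\<^sup>2 - x\<^sup>2)) * (\<phi> (t\<^sup>2) (x\<^sup>2))\<^sup>2"
  let ?R = "\<lambda>x t. (\<psi> x)\<^sup>2 * (complex_of_real (t\<^sup>2) - (\<theta> x)\<^sup>2)"
  have cosp: "cos t > 0" if "\<bar>t\<bar> < e" for t
    using that pi_gt3 by (intro cos_gt_zero_pi) (auto simp: e_def)
  have off: "?L x t = ?R x t" if "\<bar>t\<bar> < e" "\<bar>x\<bar> < e" "(tan t)\<^sup>2 \<noteq> x\<^sup>2" for t x
  proof -
    have "(\<phi> (t\<^sup>2) (x\<^sup>2))\<^sup>2 = (\<psi> x)\<^sup>2 / complex_of_real ((cos t)\<^sup>2) *
        ((complex_of_real (t\<^sup>2) - (\<theta> x)\<^sup>2) / complex_of_real ((tan t)\<^sup>2 - x\<^sup>2))"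
      using that by (subst eq) (auto simp: e_def power_mult_distrib power_divide)
    moreover have "complex_of_real ((cos t)\<^sup>2) \<noteq> 0" "complex_of_real ((tan t)\<^sup>2 - x\<^sup>2) \<noteq> 0"
      using cosp[OF that(1)] that(3) by (auto simp del: of_real_power of_real_diff)
    ultimately show ?thesis unfolding of_real_mult by (simp add: field_simps)
  qed
  have "?L x t = ?R x t" if "\<bar>t\<bar> < e" "\<bar>x\<bar> < e" for t x
  proof (rule off_diagonal_extend[where x = x and f = "?L x" and g = "?R x"])
    show "\<bar>t\<bar> < pi / 2" using that pi_gt3 by (auto simp: e_def)
    show "isCont (?L x) t"
      using cosp[OF that(1)] that
      by (intro continuous_intros isCont_o2[of t "\<lambda>t. t\<^sup>2" "\<lambda>a. \<phi> a (x\<^sup>2)"] cont square_abs_less)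
        (auto simp: e_def)
    show "isCont (?R x) t" by (intro continuous_intros)
    show "\<forall>\<^sub>F u in nhds t. (tan u)\<^sup>2 \<noteq> x\<^sup>2 \<longrightarrow> ?L x u = ?R x u"
      using eventually_nhds_abs_less[OF that(1)] by eventually_elim (use off that(2) in blast)
  qed
  moreover have "e > 0" using d r by (simp add: e_def)
  ultimately show ?thesis unfolding eventually_nhds_00 by blast
qed

section \<open>The germ of phi and the necessity of the choice of theta and psi\<close>

lemma norm_less_1_Arctan: "norm z < 1 \<Longrightarrow> Re z = 0 \<Longrightarrow> \<bar>Im z\<bar> < 1"
  using abs_Im_le_cmod[of z] by simp

lemma square_neq_minus_1: "norm z < 1 \<Longrightarrow> z\<^sup>2 \<noteq> (-1 :: complex)"
proof
  assume z: "norm z < 1" "z\<^sup>2 = -1"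
  then have "norm z ^ 2 = 1" by (simp flip: norm_power)
  moreover have "norm z ^ 2 < 1" using z(1) by (simp add: power_less_one_iff)
  ultimately show False by simp
qed

text \<open>\<open>Arctan\<close> inverts the odd function \<open>tan\<close> on the strip \<open>\<bar>Re z\<bar> < pi / 2\<close>, which is symmetric under \<open>z \<mapsto> - z\<close>.\<close>

lemma Arctan_minus:
  assumes "norm z < 1"
  shows "Arctan (- z) = - Arctan z"
proof -
  have "tan (- Arctan z) = - z"
    using square_neq_minus_1[OF assms] by simp
  moreover have "\<bar>Re (- Arctan z)\<bar> < pi / 2"
    using Re_Arctan_bounds[of z] norm_less_1_Arctan[OF assms] by simp
  ultimately show ?thesis using Arctan_tan[of "- Arctan z"] by simp
qed

lemma cos_Arctan_nonzero:
  assumes "norm z < 1"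
  shows "cos (Arctan z) \<noteq> 0"
proof
  assume "cos (Arctan z) = 0"
  then have "tan (Arctan z) = 0" by (simp add: tan_def)
  then have "z = 0" using square_neq_minus_1[OF assms] by simp
  with \<open>cos (Arctan z) = 0\<close> show False by simp
qed

lemma holomorphic_on_Arctan_ball: "r \<le> 1 \<Longrightarrow> Arctan holomorphic_on ball 0 r"
  by (rule holomorphic_on_Arctan) (auto intro: norm_less_1_Arctan)

lemma Arctan_small: "\<exists>\<delta>>0. \<delta> \<le> 1 \<and> (\<forall>z. norm z < \<delta> \<longrightarrow> norm (Arctan z) < 1)"
proof -
  have "isCont Arctan 0" by (intro continuous_at_Arctan) simp
  from LIM_D[OF isContD[OF this], of 1] obtain d where "d > 0"
    "\<And>z. z \<noteq> 0 \<Longrightarrow> norm z < d \<Longrightarrow> norm (Arctan z) < 1" by auto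
  then have "norm (Arctan z) < 1" if "norm z < min d 1" for z
    using that by (cases "z = 0") auto
  with \<open>d > 0\<close> show ?thesis by (intro exI[of _ "min d 1"]) auto
qed

lemma analytic_near_0_arctan: "analytic_near_0 (\<lambda>x. complex_of_real (arctan x))"
  by (rule analytic_near_0_of_holomorphic[of 1 Arctan])
    (auto intro: holomorphic_on_Arctan_ball simp: Arctan_of_real)

text \<open>In this form the quotient is visibly analytic and positive at \<open>x = 0\<close> as well.\<close>

lemma arctan_quot_eq: "arctan_quot x = sinc (arctan x) / cos (arctan x)"
  by (simp add: arctan_quot_cos[symmetric])

lemma arctan_quot_pos: "0 < arctan_quot x"
proof -
  have "0 < cos (arctan x)" using abs_arctan_less[of x] by (intro cos_gt_zero_pi) auto
  moreover have "0 < sinc (arctan x)" using abs_arctan_less[of x] pi_gt_zero by (intro sinc_pos) linarith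
  ultimately show ?thesis by (simp add: arctan_quot_eq)
qed

lemma arctan_quot_minus: "arctan_quot (- x) = arctan_quot x"
  by (simp add: arctan_quot_def arctan_minus)

lemma analytic_near_0_arctan_quot: "analytic_near_0 (\<lambda>x. complex_of_real (arctan_quot x))"
proof (rule analytic_near_0_of_holomorphic[of 1 "\<lambda>z. sinc (Arctan z) / cos (Arctan z)"])
  have "(sinc \<circ> Arctan) holomorphic_on ball 0 1"
    by (rule holomorphic_on_compose[OF holomorphic_on_Arctan_ball holomorphic_on_sinc]) simp
  moreover have "(cos \<circ> Arctan) holomorphic_on ball 0 1"
    by (rule holomorphic_on_compose[OF holomorphic_on_Arctan_ball holomorphic_on_cos]) simp
  ultimately show "(\<lambda>z. sinc (Arctan z) / cos (Arctan z)) holomorphic_on ball 0 1"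
    unfolding o_def by (rule holomorphic_on_divide) (simp add: cos_Arctan_nonzero)
qed (auto simp: Arctan_of_real sinc_of_real cos_of_real arctan_quot_eq)

lemma mid_kernel_nonzero:
  assumes "\<bar>t\<bar> < pi / 2" "\<bar>s\<bar> < pi / 2"
  shows "mid_kernel t s \<noteq> 0"
proof -
  have "0 < sinc (t - s)" "0 < sinc (t + s)"
    using assms by (auto intro!: sinc_pos)
  then show ?thesis by (simp add: mid_kernel_real[OF assms])
qed

lemma mid_kernel_minus: "mid_kernel t (- s) = mid_kernel t s"
  by (simp add: mid_kernel_def mult.commute)

lemma isCont_mid_kernel:
  assumes "\<bar>t\<bar> < pi / 2" "\<bar>s\<bar> < pi / 2"
  shows "isCont (\<lambda>t. mid_kernel t s) t"
proof -
  have rs: "isCont inv_sqrt_sinc (complex_of_real y)" if "\<bar>y\<bar> < pi" for y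
    using holomorphic_on_imp_continuous_on[OF inv_sqrt_sinc_holomorphic] that
    by (simp add: continuous_on_eq_continuous_at)
  have "isCont (\<lambda>t. inv_sqrt_sinc (complex_of_real (t - s))) t"
    by (rule isCont_o2[of t "\<lambda>t. complex_of_real (t - s)" inv_sqrt_sinc])
      (use assms in \<open>auto intro!: rs simp del: of_real_diff simp: continuous_intros\<close>)
  moreover have "isCont (\<lambda>t. inv_sqrt_sinc (complex_of_real (t + s))) t"
    by (rule isCont_o2[of t "\<lambda>t. complex_of_real (t + s)" inv_sqrt_sinc])
      (use assms in \<open>auto intro!: rs simp del: of_real_add simp: continuous_intros\<close>)
  ultimately show ?thesis unfolding mid_kernel_def by (rule continuous_mult)
qed

lemma defines_phi_arctan_iff:
  assumes "arctan_up_to_sign \<theta>"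
  shows "defines_phi \<theta> \<psi> \<phi> \<longleftrightarrow> (\<forall>\<^sub>F (t, x) in nhds (0, 0). (tan t)\<^sup>2 \<noteq> x\<^sup>2 \<longrightarrow>
     \<phi> (t\<^sup>2) (x\<^sup>2) = \<psi> x * complex_of_real (cos (arctan x)) * mid_kernel t (arctan x))"
proof -
  have "\<forall>\<^sub>F x in nhds 0. (\<theta> x)\<^sup>2 = (complex_of_real (arctan x))\<^sup>2"
    using assms unfolding arctan_up_to_sign_def by (auto elim: eventually_mono)
  then obtain d where d: "d > 0" "\<And>x. \<bar>x\<bar> < d \<Longrightarrow> (\<theta> x)\<^sup>2 = (complex_of_real (arctan x))\<^sup>2"
    unfolding eventually_nhds_0 by blast
  define e where "e = min d 1"
  have e: "e > 0" using d by (simp add: e_def)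
  have eq: "\<psi> x / complex_of_real (cos t) *
          csqrt ((complex_of_real (t\<^sup>2) - (\<theta> x)\<^sup>2) / complex_of_real ((tan t)\<^sup>2 - x\<^sup>2)) =
        \<psi> x * complex_of_real (cos (arctan x)) * mid_kernel t (arctan x)"
    if "\<bar>t\<bar> < e" "\<bar>x\<bar> < e" "(tan t)\<^sup>2 \<noteq> x\<^sup>2" for t x
  proof -
    have t: "\<bar>t\<bar> < pi / 2" using that pi_gt3 by (auto simp: e_def)
    then have "cos t > 0" by (intro cos_gt_zero_pi) auto
    then show ?thesis
      using csqrt_midpoint_quotient[OF t that(3)] d(2)[of x] that by (simp add: e_def)
  qed
  have near: "\<forall>\<^sub>F (t, x) in nhds (0, 0). \<bar>t\<bar> < e \<and> \<bar>x\<bar> < e"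
    unfolding eventually_nhds_00 using e by blast
  show ?thesis
    unfolding defines_phi_def
    by (intro eventually_subst eventually_mono[OF near], simp only: split_paired_all prod.case)
      (use eq in metis)
qed

text \<open>Here \<open>\<phi>\<close> is known on the exceptional set too, because it is continuous in its first argument and so is the product formula.\<close>

lemma phi_germ_arctan:
  assumes "arctan_up_to_sign \<theta>" and def: "defines_phi \<theta> \<psi> \<phi>" and an: "analytic_near_00 \<phi>"
  shows "\<forall>\<^sub>F (t, x) in nhds (0, 0).
     \<phi> (t\<^sup>2) (x\<^sup>2) = \<psi> x * complex_of_real (cos (arctan x)) * mid_kernel t (arctan x)"
proof -
  obtain r where r: "r > 0" and cont: "\<And>p q. \<bar>p\<bar> < r \<Longrightarrow> \<bar>q\<bar> < r \<Longrightarrow> isCont (\<lambda>x. \<phi> x q) p"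
    by (rule analytic_near_00_isCont[OF an]) (rule that)
  obtain d where d: "d > 0" and off: "\<And>t x. \<bar>t\<bar> < d \<Longrightarrow> \<bar>x\<bar> < d \<Longrightarrow> (tan t)\<^sup>2 \<noteq> x\<^sup>2 \<Longrightarrow>
       \<phi> (t\<^sup>2) (x\<^sup>2) = \<psi> x * complex_of_real (cos (arctan x)) * mid_kernel t (arctan x)"
    using def unfolding defines_phi_arctan_iff[OF assms(1)] eventually_nhds_00 by blast
  define e where "e = min d (min r 1)"
  have "\<phi> (t\<^sup>2) (x\<^sup>2) = \<psi> x * complex_of_real (cos (arctan x)) * mid_kernel t (arctan x)"
    if "\<bar>t\<bar> < e" "\<bar>x\<bar> < e" for t x
  proof (rule off_diagonal_extend[where x = x and f = "\<lambda>t. \<phi> (t\<^sup>2) (x\<^sup>2)"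
        and g = "\<lambda>t. \<psi> x * complex_of_real (cos (arctan x)) * mid_kernel t (arctan x)"])
    show t: "\<bar>t\<bar> < pi / 2" using that pi_gt3 by (auto simp: e_def)
    show "isCont (\<lambda>t. \<phi> (t\<^sup>2) (x\<^sup>2)) t"
      using that
      by (intro isCont_o2[of t "\<lambda>t. t\<^sup>2" "\<lambda>a. \<phi> a (x\<^sup>2)"] cont square_abs_less continuous_intros)
        (auto simp: e_def)
    show "isCont (\<lambda>t. \<psi> x * complex_of_real (cos (arctan x)) * mid_kernel t (arctan x)) t"
      by (intro continuous_mult continuous_const isCont_mid_kernel t abs_arctan_less)
    show "\<forall>\<^sub>F u in nhds t. (tan u)\<^sup>2 \<noteq> x\<^sup>2 \<longrightarrow>
       \<phi> (u\<^sup>2) (x\<^sup>2) = \<psi> x * complex_of_real (cos (arctan x)) * mid_kernel u (arctan x)"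
      using eventually_nhds_abs_less[OF that(1)]
      by eventually_elim (use off that(2) in \<open>auto simp: e_def\<close>)
  qed
  moreover have "e > 0" using d r by (simp add: e_def)
  ultimately show ?thesis unfolding eventually_nhds_00 by blast
qed

lemma phi_germ_phi_mid:
  assumes "analytic_near_00 \<phi>"
    "defines_phi (\<lambda>x. complex_of_real (arctan x)) (\<lambda>x. complex_of_real (arctan_quot x)) \<phi>"
  shows "\<forall>\<^sub>F (t, x) in nhds (0, 0). \<phi> (t\<^sup>2) (x\<^sup>2) = complex_of_real (phi_mid t x)"
proof -
  have "arctan_up_to_sign (\<lambda>x. complex_of_real (arctan x))" by (simp add: arctan_up_to_sign_def)
  from phi_germ_arctan[OF this assms(2,1)] obtain d where d: "d > 0"
    "\<And>t x. \<bar>t\<bar> < d \<Longrightarrow> \<bar>x\<bar> < d \<Longrightarrow> \<phi> (t\<^sup>2) (x\<^sup>2) =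
       complex_of_real (arctan_quot x) * complex_of_real (cos (arctan x)) * mid_kernel t (arctan x)"
    unfolding eventually_nhds_00 by blast
  have "\<phi> (t\<^sup>2) (x\<^sup>2) = complex_of_real (phi_mid t x)" if "\<bar>t\<bar> < min d 1" "\<bar>x\<bar> < min d 1" for t x
  proof -
    have t: "\<bar>t\<bar> < pi / 2" using that pi_gt3 by auto
    have "\<phi> (t\<^sup>2) (x\<^sup>2) = complex_of_real (sinc (arctan x)) * mid_kernel t (arctan x)"
      using that d(2)[of t x] by (simp flip: of_real_mult add: arctan_quot_cos)
    then show ?thesis
      by (simp add: phi_mid_eq[OF t] mid_symbol_def mid_kernel_real[OF t abs_arctan_less])
  qed
  then show ?thesis unfolding eventually_nhds_00 using d(1) by (intro exI[of _ "min d 1"]) auto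
qed

text \<open>At \<open>t = 0\<close> the kernel is \<open>F(-s) F(s) = 1 / sinc s\<close>, and \<open>cos s / sinc s\<close> is the reciprocal of \<open>x / arctan x\<close>.\<close>

lemma phi_at_time_0:
  assumes "arctan_up_to_sign \<theta>" "defines_phi \<theta> \<psi> \<phi>"
  shows "\<forall>\<^sub>F x in at 0. \<phi> 0 (x\<^sup>2) = \<psi> x / complex_of_real (arctan_quot x)"
proof -
  obtain d where d: "d > 0" and off: "\<And>t x. \<bar>t\<bar> < d \<Longrightarrow> \<bar>x\<bar> < d \<Longrightarrow> (tan t)\<^sup>2 \<noteq> x\<^sup>2 \<Longrightarrow>
       \<phi> (t\<^sup>2) (x\<^sup>2) = \<psi> x * complex_of_real (cos (arctan x)) * mid_kernel t (arctan x)"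
    using assms(2) unfolding defines_phi_arctan_iff[OF assms(1)] eventually_nhds_00 by blast
  have "\<phi> 0 (x\<^sup>2) = \<psi> x / complex_of_real (arctan_quot x)" if "x \<noteq> 0" "\<bar>x\<bar> < d" for x
  proof -
    have s: "\<bar>arctan x\<bar> < pi / 2" by (rule abs_arctan_less)
    then have "0 < sinc (arctan x)" by (intro sinc_pos) auto
    then have "mid_kernel 0 (arctan x) = complex_of_real (1 / sinc (arctan x))"
      using s by (subst mid_kernel_real) auto
    then show ?thesis
      using off[of 0 x] that d by (simp add: arctan_quot_eq)
  qed
  then show ?thesis unfolding eventually_at using d
    by (intro exI[of _ d]) (auto simp: dist_real_def)
qed

text \<open>The values \<open>\<phi> 0 (x\<^sup>2)\<close> determine \<open>\<phi> 0 y\<close> only for positive \<open>y\<close>; analyticity of \<open>\<phi> 0\<close> extends the conclusion to negative \<open>y\<close>.\<close>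

lemma normalisation_iff:
  assumes an: "analytic_near_0 \<psi>" and \<theta>: "arctan_up_to_sign \<theta>"
    and \<phi>: "analytic_near_00 \<phi>" "defines_phi \<theta> \<psi> \<phi>"
  shows "(\<forall>\<^sub>F y in nhds 0. \<phi> 0 y = 1) \<longleftrightarrow> (\<forall>\<^sub>F x in nhds 0. \<psi> x = complex_of_real (arctan_quot x))"
proof
  note at0 = phi_at_time_0[OF \<theta> \<phi>(2)]
  have sq: "filterlim (\<lambda>x::real. x\<^sup>2) (nhds 0) (at 0)"
    using tendsto_power[OF tendsto_ident_at[of "0::real" UNIV], of 2] by simp
  {
    assume "\<forall>\<^sub>F y in nhds 0. \<phi> 0 y = 1"
    then have "\<forall>\<^sub>F x in at 0. \<phi> 0 (x\<^sup>2) = 1" using sq by (rule eventually_compose_filterlim)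
    with at0 have "\<forall>\<^sub>F x in at 0. \<psi> x - complex_of_real (arctan_quot x) = 0"
      by eventually_elim (use arctan_quot_pos in \<open>auto simp: field_simps order_less_irrefl\<close>)
    then have "\<forall>\<^sub>F x in nhds 0. \<psi> x - complex_of_real (arctan_quot x) = 0"
      by (intro analytic_near_0_eq_zero analytic_near_0_sub an analytic_near_0_arctan_quot
          eventually_frequently) auto
    then show "\<forall>\<^sub>F x in nhds 0. \<psi> x = complex_of_real (arctan_quot x)" by simp
  next
    assume "\<forall>\<^sub>F x in nhds 0. \<psi> x = complex_of_real (arctan_quot x)"
    then have "\<forall>\<^sub>F x in at 0. \<psi> x = complex_of_real (arctan_quot x)"
      by (simp add: eventually_at_filter eventually_mono)
    with at0 have one: "\<forall>\<^sub>F x in at 0. \<phi> 0 (x\<^sup>2) = 1"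
      by eventually_elim (use arctan_quot_pos in \<open>auto simp: less_le\<close>)
    obtain r where r: "r > 0" and sec: "\<And>p q. \<bar>p\<bar> < r \<Longrightarrow> \<bar>q\<bar> < r \<Longrightarrow> analytic_near_0 (\<lambda>u. \<phi> p (q + u))"
      by (rule analytic_near_00_sections[OF \<phi>(1)]) (rule that)
    have "analytic_near_0 (\<phi> 0)" using sec[of 0 0] r by simp
    then have an1: "analytic_near_0 (\<lambda>y. \<phi> 0 y - 1)" by (intro analytic_near_0_sub analytic_near_0_const)
    have "\<not> (\<forall>\<^sub>F y in at 0. \<phi> 0 y - 1 \<noteq> 0)"
    proof
      assume "\<forall>\<^sub>F y in at 0. \<phi> 0 y - 1 \<noteq> 0"
      moreover have "filterlim (\<lambda>x::real. x\<^sup>2) (at 0) (at 0)"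
        using sq by (auto simp: filterlim_at eventually_at_filter)
      ultimately have "\<forall>\<^sub>F x in at 0. \<phi> 0 (x\<^sup>2) - 1 \<noteq> 0"
        by (rule eventually_compose_filterlim)
      with one have "\<forall>\<^sub>F x in at (0::real). False" by eventually_elim simp
      then show False by simp
    qed
    then have "\<forall>\<^sub>F y in nhds 0. \<phi> 0 y - 1 = 0" using analytic_near_0_dichotomy[OF an1] by blast
    then show "\<forall>\<^sub>F y in nhds 0. \<phi> 0 y = 1" by simp
  }
qed

text \<open>From \<open>(\<theta> - arctan) (\<theta> + arctan) = 0\<close> on a punctured neighbourhood one factor must vanish identically, since otherwise both would be nonzero close to the origin.\<close>

lemma theta_necessary:
  assumes \<theta>: "analytic_near_0 \<theta>" and \<psi>: "analytic_near_0 \<psi>" and nz: "\<not> (\<forall>\<^sub>F x in nhds 0. \<psi> x = 0)"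
    and \<phi>: "analytic_near_00 \<phi>" "defines_phi \<theta> \<psi> \<phi>"
  shows "arctan_up_to_sign \<theta>"
proof -
  obtain d where d: "d > 0" and id: "\<And>t x. \<bar>t\<bar> < d \<Longrightarrow> \<bar>x\<bar> < d \<Longrightarrow>
      complex_of_real ((cos t)\<^sup>2 * ((tan t)\<^sup>2 - x\<^sup>2)) * (\<phi> (t\<^sup>2) (x\<^sup>2))\<^sup>2 =
         (\<psi> x)\<^sup>2 * (complex_of_real (t\<^sup>2) - (\<theta> x)\<^sup>2)"
    using defining_identity[OF \<phi>] unfolding eventually_nhds_00 by blast
  have "\<forall>\<^sub>F x in nhds 0. \<bar>arctan x\<bar> < d"
  proof (rule order_tendstoD(2)[OF tendsto_rabs])
    show "(arctan \<longlongrightarrow> arctan 0) (nhds 0)"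
      using isCont_arctan[of 0] unfolding continuous_within tendsto_at_iff_tendsto_nhds .
  qed (use d in simp)
  moreover have "\<forall>\<^sub>F x in nhds 0. \<bar>x\<bar> < d" using d by (intro eventually_nhds_abs_less) simp
  ultimately have "\<forall>\<^sub>F x in nhds 0. (\<psi> x)\<^sup>2 * ((complex_of_real (arctan x))\<^sup>2 - (\<theta> x)\<^sup>2) = 0"
  proof eventually_elim
    case (elim x)
    with id[of "arctan x" x] show ?case by (simp add: tan_arctan)
  qed
  then have "\<forall>\<^sub>F x in at 0. (\<psi> x)\<^sup>2 * ((complex_of_real (arctan x))\<^sup>2 - (\<theta> x)\<^sup>2) = 0"
    by (simp add: eventually_at_filter eventually_mono)
  moreover have "\<forall>\<^sub>F x in at 0. \<psi> x \<noteq> 0" using analytic_near_0_dichotomy[OF \<psi>] nz by blast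
  ultimately have prod: "\<forall>\<^sub>F x in at 0.
      (\<theta> x - complex_of_real (arctan x)) * (\<theta> x - - complex_of_real (arctan x)) = 0"
    by eventually_elim (simp add: power2_eq_square algebra_simps)
  have d1: "analytic_near_0 (\<lambda>x. \<theta> x - complex_of_real (arctan x))"
    and d2: "analytic_near_0 (\<lambda>x. \<theta> x - - complex_of_real (arctan x))"
    by (intro analytic_near_0_sub analytic_near_0_minus \<theta> analytic_near_0_arctan)+
  have "\<not> ((\<forall>\<^sub>F x in at 0. \<theta> x - complex_of_real (arctan x) \<noteq> 0) \<and>
      (\<forall>\<^sub>F x in at 0. \<theta> x - - complex_of_real (arctan x) \<noteq> 0))"
  proof
    assume "(\<forall>\<^sub>F x in at 0. \<theta> x - complex_of_real (arctan x) \<noteq> 0) \<and>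
      (\<forall>\<^sub>F x in at 0. \<theta> x - - complex_of_real (arctan x) \<noteq> 0)"
    then have "\<forall>\<^sub>F x in at 0. \<theta> x - complex_of_real (arctan x) \<noteq> 0 \<and> \<theta> x - - complex_of_real (arctan x) \<noteq> 0"
      by (simp add: eventually_conj_iff)
    with prod have "\<forall>\<^sub>F x in at (0::real). False" by eventually_elim (metis mult_eq_0_iff)
    then show False by simp
  qed
  with analytic_near_0_dichotomy[OF d1] analytic_near_0_dichotomy[OF d2]
  have "(\<forall>\<^sub>F x in nhds 0. \<theta> x - complex_of_real (arctan x) = 0) \<or>
      (\<forall>\<^sub>F x in nhds 0. \<theta> x - - complex_of_real (arctan x) = 0)" by blast
  then show ?thesis unfolding arctan_up_to_sign_def by (simp only: right_minus_eq)
qed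

text \<open>The left-hand side does not change when \<open>x\<close> becomes \<open>- x\<close>, and \<open>\<psi>\<close> is multiplied by something nonzero and even. Any \<open>t\<close> with a nonzero denominator can be used for the comparison.\<close>

lemma psi_even:
  assumes \<theta>: "arctan_up_to_sign \<theta>" and def: "defines_phi \<theta> \<psi> \<phi>"
  shows "\<forall>\<^sub>F x in nhds 0. \<psi> (- x) = \<psi> x"
proof -
  obtain d where d: "d > 0" and off: "\<And>t x. \<bar>t\<bar> < d \<Longrightarrow> \<bar>x\<bar> < d \<Longrightarrow> (tan t)\<^sup>2 \<noteq> x\<^sup>2 \<Longrightarrow>
       \<phi> (t\<^sup>2) (x\<^sup>2) = \<psi> x * complex_of_real (cos (arctan x)) * mid_kernel t (arctan x)"
    using def unfolding defines_phi_arctan_iff[OF \<theta>] eventually_nhds_00 by blast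
  have "\<psi> (- x) = \<psi> x" if x: "\<bar>x\<bar> < d" for x
  proof -
    have "\<forall>\<^sub>F t in at (0::real). \<bar>t\<bar> < d"
      using d eventually_nhds_abs_less[of 0 d] by (simp add: eventually_at_filter eventually_mono)
    moreover have "\<forall>\<^sub>F t in at (0::real). \<bar>t\<bar> < pi / 2 \<and> (tan t)\<^sup>2 \<noteq> x\<^sup>2"
      by (rule eventually_off_diagonal) simp
    ultimately have "\<forall>\<^sub>F t in at (0::real). \<bar>t\<bar> < d \<and> \<bar>t\<bar> < pi / 2 \<and> (tan t)\<^sup>2 \<noteq> x\<^sup>2"
      by (rule eventually_conj)
    then obtain t where t: "\<bar>t\<bar> < pi / 2" "(tan t)\<^sup>2 \<noteq> x\<^sup>2" "\<bar>t\<bar> < d"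
      using eventually_happens' trivial_limit_at by blast
    have "\<psi> x * complex_of_real (cos (arctan x)) * mid_kernel t (arctan x) =
        \<psi> (- x) * complex_of_real (cos (arctan (- x))) * mid_kernel t (arctan (- x))"
      using off[OF t(3) x t(2)] off[of t "- x"] t x by simp
    moreover have "mid_kernel t (arctan x) \<noteq> 0" using t abs_arctan_less by (intro mid_kernel_nonzero)
    ultimately show ?thesis by (simp add: arctan_minus mid_kernel_minus)
  qed
  with d show ?thesis unfolding eventually_nhds_0 by blast
qed

section \<open>Existence of the analytic germ, and its coefficients in time\<close>

lemma holomorphic_bounded_on_cball:
  fixes f :: "complex \<Rightarrow> complex"
  assumes "f holomorphic_on A" "cball 0 r \<subseteq> A"
  obtains B where "0 \<le> B" "\<And>z. norm z \<le> r \<Longrightarrow> norm (f z) \<le> B"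
proof -
  have "bounded (f ` cball 0 r)"
    using assms by (intro compact_imp_bounded compact_continuous_image compact_cball
        holomorphic_on_imp_continuous_on holomorphic_on_subset[OF assms(1)])
  then obtain B where B: "B > 0" "\<And>y. y \<in> f ` cball 0 r \<Longrightarrow> norm y \<le> B"
    unfolding bounded_pos by blast
  show thesis by (rule that[of B]) (use B in auto)
qed

lemma inv_sqrt_sinc_shift_holomorphic:
  assumes "r + norm s \<le> pi"
  shows "(\<lambda>t. inv_sqrt_sinc (t - s)) holomorphic_on ball 0 r" "(\<lambda>t. inv_sqrt_sinc (t + s)) holomorphic_on ball 0 r"
proof -
  have *: "(\<lambda>t. inv_sqrt_sinc (t + w)) holomorphic_on ball 0 r" if "norm w = norm s" for w
  proof (rule holomorphic_on_compose_gen[of "\<lambda>t. t + w" _ inv_sqrt_sinc "ball 0 pi", unfolded o_def])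
    show "(\<lambda>t. t + w) ` ball 0 r \<subseteq> ball 0 pi"
    proof (clarsimp)
      fix t :: complex assume "norm t < r"
      then show "norm (t + w) < pi" using norm_triangle_ineq[of t w] assms that by linarith
    qed
  qed (auto intro!: holomorphic_intros inv_sqrt_sinc_holomorphic)
  show "(\<lambda>t. inv_sqrt_sinc (t + s)) holomorphic_on ball 0 r" by (rule *) simp
  show "(\<lambda>t. inv_sqrt_sinc (t - s)) holomorphic_on ball 0 r" using *[of "- s"] by simp
qed

lemma even_holomorphic_extension:
  assumes "r > 0" and hol: "P holomorphic_on ball 0 r"
    and eq: "\<And>x. \<bar>x\<bar> < r \<Longrightarrow> f x = P (complex_of_real x)"
    and even: "\<forall>\<^sub>F x in nhds 0. f (- x) = f x"
    and z: "norm z < r"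
  shows "P (- z) = P z"
proof -
  define D where "D z = P (- z) - P z" for z
  have "(P \<circ> uminus) holomorphic_on ball 0 r"
    by (rule holomorphic_on_compose_gen[OF _ hol]) (auto intro!: holomorphic_intros)
  then have hD: "D holomorphic_on ball 0 r"
    unfolding D_def by (intro holomorphic_on_diff hol) (simp_all add: o_def)
  have "\<forall>\<^sub>F x in at 0. f (- x) = f x" "\<forall>\<^sub>F x::real in at 0. \<bar>x\<bar> < r"
    using even eventually_nhds_abs_less[of 0 r] \<open>r > 0\<close> by (simp_all add: eventually_at_filter eventually_mono)
  then have D0: "\<forall>\<^sub>F x in at 0. D (complex_of_real x) = 0"
  proof eventually_elim
    case (elim x)
    then show ?case using eq[of x] eq[of "- x"] by (simp add: D_def)
  qed
  have "\<not> (\<forall>\<^sub>F z in at 0. D z \<noteq> 0)"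
  proof
    assume "\<forall>\<^sub>F z in at 0. D z \<noteq> 0"
    from eventually_at_0_of_real[OF this] D0 have "\<forall>\<^sub>F x in at (0::real). False"
      by eventually_elim simp
    then show False by simp
  qed
  with holomorphic_dichotomy[OF \<open>r > 0\<close> hD] z show ?thesis by (simp add: D_def)
qed

text \<open>The product formula is continued to a bidisc on which \<open>\<bar>t \<plusminus> Arctan x\<bar> < 2 < pi\<close>. It is even in \<open>t\<close> because \<open>F\<close> is even, and even in \<open>x\<close> because \<open>Arctan\<close> is odd, which merely exchanges the two factors. Substituting \<open>csqrt a\<close> and \<open>csqrt b\<close> therefore yields a separately holomorphic function of \<open>a = t\<^sup>2\<close> and \<open>b = x\<^sup>2\<close>.\<close>

lemma phi_exists:
  assumes \<psi>: "analytic_near_0 \<psi>" and even: "\<forall>\<^sub>F x in nhds 0. \<psi> (- x) = \<psi> x"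
    and \<theta>: "arctan_up_to_sign \<theta>"
  shows "\<exists>\<phi>. analytic_near_00 \<phi> \<and> defines_phi \<theta> \<psi> \<phi>"
proof -
  obtain r P where r: "r > 0" and P: "P holomorphic_on ball 0 r"
    and \<psi>P: "\<And>x. \<bar>x\<bar> < r \<Longrightarrow> \<psi> x = P (complex_of_real x)"
    by (rule analytic_near_0_holomorphicE[OF \<psi>]) (rule that)
  obtain \<delta> where \<delta>: "\<delta> > 0" "\<delta> \<le> 1" and A1: "\<And>z. norm z < \<delta> \<Longrightarrow> norm (Arctan z) < 1"
    using Arctan_small by blast
  \<comment> \<open>The factor 1/2 leaves a closed disc inside the domain of \<open>q\<close>, on which \<open>q\<close> is bounded.\<close>
  define \<rho> where "\<rho> = min r \<delta> / 2"
  have \<rho>: "0 < \<rho>" "\<rho> < r" "\<rho> < \<delta>" "\<rho> < 1" using r \<delta> by (auto simp: \<rho>_def)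
  define q where "q z = P z * cos (Arctan z)" for z
  have "(cos \<circ> Arctan) holomorphic_on ball 0 (min r \<delta>)"
    by (rule holomorphic_on_compose[OF holomorphic_on_Arctan_ball holomorphic_on_cos]) (use \<delta> in auto)
  then have q: "q holomorphic_on ball 0 (min r \<delta>)"
    unfolding q_def o_def by (intro holomorphic_on_mult holomorphic_on_subset[OF P]) auto
  have qeven: "q (- z) = q z" if "norm z < \<rho>" for z
    using even_holomorphic_extension[OF r P \<psi>P even, of z] Arctan_minus[of z] that \<rho> by (simp add: q_def)
  obtain C where C: "0 \<le> C" "\<And>z. norm z \<le> \<rho> \<Longrightarrow> norm (q z) \<le> C"
    by (rule holomorphic_bounded_on_cball[OF q, of \<rho>]) (use \<rho> that in auto)
  obtain B where B: "0 \<le> B" "\<And>z. norm z \<le> 2 \<Longrightarrow> norm (inv_sqrt_sinc z) \<le> B"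
    by (rule holomorphic_bounded_on_cball[OF inv_sqrt_sinc_holomorphic, of 2]) (use pi_gt3 that in auto)
  define f where "f t x = q x * (inv_sqrt_sinc (t - Arctan x) * inv_sqrt_sinc (t + Arctan x))" for t x
  have bounds: "norm (t - Arctan x) < 2" "norm (t + Arctan x) < 2" "norm (Arctan x) < 1"
    if "norm t < \<rho>" "norm x < \<rho>" for t x
    using norm_triangle_ineq4[of t "Arctan x"] norm_triangle_ineq[of t "Arctan x"] A1[of x] that \<rho> by auto
  have f_t: "(\<lambda>t. f t x) holomorphic_on ball 0 \<rho>" if "norm x < \<rho>" for x
    unfolding f_def using A1[of x] that \<rho> pi_gt3
    by (intro holomorphic_on_mult holomorphic_on_const inv_sqrt_sinc_shift_holomorphic) auto
  have f_x: "f t holomorphic_on ball 0 \<rho>" if t: "norm t < \<rho>" for t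
  proof -
    have "(\<lambda>x. inv_sqrt_sinc (t - Arctan x)) holomorphic_on ball 0 \<rho>"
      by (rule holomorphic_on_compose_gen[OF _ inv_sqrt_sinc_holomorphic, of "\<lambda>x. t - Arctan x", unfolded o_def])
        (use bounds[OF t] \<rho> pi_gt3 in \<open>auto intro!: holomorphic_intros holomorphic_on_Arctan_ball less_trans[OF bounds(1)[OF t]]\<close>)
    moreover have "(\<lambda>x. inv_sqrt_sinc (t + Arctan x)) holomorphic_on ball 0 \<rho>"
      by (rule holomorphic_on_compose_gen[OF _ inv_sqrt_sinc_holomorphic, of "\<lambda>x. t + Arctan x", unfolded o_def])
        (use bounds[OF t] \<rho> pi_gt3 in \<open>auto intro!: holomorphic_intros holomorphic_on_Arctan_ball less_trans[OF bounds(2)[OF t]]\<close>)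
    ultimately show ?thesis
      unfolding f_def using \<rho> by (intro holomorphic_on_mult holomorphic_on_subset[OF q]) auto
  qed
  have rs: "inv_sqrt_sinc (- w) = inv_sqrt_sinc w" if "norm w < 2" for w
    using that pi_gt3 by (intro inv_sqrt_sinc_minus) simp
  have t_even: "f (- t) x = f t x" if "norm t < \<rho>" "norm x < \<rho>" for t x
    using rs[OF bounds(1)[OF that]] rs[OF bounds(2)[OF that]] by (simp add: f_def algebra_simps)
  have x_even: "f t (- x) = f t x" if "norm x < \<rho>" for t x
    using Arctan_minus[of x] that \<rho> by (simp add: f_def qeven algebra_simps)
  have cs: "norm (csqrt w) < \<rho>" if "norm w < \<rho>\<^sup>2" for w
    using that \<rho> by (simp add: real_less_lsqrt)
  interpret bounded_separately_holomorphic "\<rho>\<^sup>2" "C * (B * B)" "\<lambda>a b. f (csqrt a) (csqrt b)"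
  proof
    show "0 < \<rho>\<^sup>2" using \<rho> by simp
    show "(\<lambda>a. f (csqrt a) (csqrt b)) holomorphic_on ball 0 (\<rho>\<^sup>2)" if "norm b < \<rho>\<^sup>2" for b
      by (rule holomorphic_even_csqrt[OF \<rho>(1) f_t]) (use cs[OF that] t_even in auto)
    show "(\<lambda>b. f (csqrt a) (csqrt b)) holomorphic_on ball 0 (\<rho>\<^sup>2)" if "norm a < \<rho>\<^sup>2" for a
      by (rule holomorphic_even_csqrt[OF \<rho>(1) f_x]) (use cs[OF that] x_even in auto)
    show "norm (f (csqrt a) (csqrt b)) \<le> C * (B * B)" if "norm a < \<rho>\<^sup>2" "norm b < \<rho>\<^sup>2" for a b
      unfolding f_def norm_mult using cs[OF that(2)] bounds[OF cs[OF that(1)] cs[OF that(2)]]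
      by (intro mult_mono C B mult_nonneg_nonneg norm_ge_zero) auto
  qed
  define \<phi> where "\<phi> x y = f (csqrt (complex_of_real x)) (csqrt (complex_of_real y))" for x y
  have cs2: "csqrt (complex_of_real (y\<^sup>2)) = complex_of_real y \<or>
      csqrt (complex_of_real (y\<^sup>2)) = - complex_of_real y" for y
    by (subst csqrt_of_real) (auto simp: abs_if)
  have "\<phi> (t\<^sup>2) (x\<^sup>2) = \<psi> x * complex_of_real (cos (arctan x)) * mid_kernel t (arctan x)"
    if "\<bar>t\<bar> < \<rho>" "\<bar>x\<bar> < \<rho>" for t x
  proof -
    have "\<phi> (t\<^sup>2) (x\<^sup>2) = f (complex_of_real t) (complex_of_real x)"
      using cs2[of t] cs2[of x] t_even[of "complex_of_real t"] x_even[of "complex_of_real x"] that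
      unfolding \<phi>_def by (metis norm_minus_cancel norm_of_real)
    also have "\<dots> = \<psi> x * complex_of_real (cos (arctan x)) * mid_kernel t (arctan x)"
      using that \<rho> by (simp add: f_def q_def \<psi>P mid_kernel_def Arctan_of_real cos_of_real)
    finally show ?thesis .
  qed
  then have "defines_phi \<theta> \<psi> \<phi>"
    unfolding defines_phi_arctan_iff[OF \<theta>] eventually_nhds_00 using \<rho>(1) by blast
  moreover have "analytic_near_00 \<phi>"
    unfolding \<phi>_def by (rule analytic_near_00_of_real)
  ultimately show ?thesis by blast
qed

lemma power_series_higher_deriv:
  fixes f :: "real \<Rightarrow> real"
  assumes "r > 0" and "\<And>t. \<bar>t\<bar> < r \<Longrightarrow> (\<lambda>n. c n * t ^ n) sums f t"
  shows "(deriv ^^ k) f 0 = fact k * c k"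
  using assms(2)
proof (induction k arbitrary: f c)
  case 0
  from "0"[of 0] \<open>r > 0\<close> show ?case by (simp add: powser_sums_zero_iff)
next
  case (Suc k)
  have summable: "summable (\<lambda>n. c n * t ^ n)" if "\<bar>t\<bar> < r" for t
    using Suc.prems[OF that] by (rule sums_summable)
  have "(\<lambda>n. diffs c n * t ^ n) sums deriv f t" if t: "\<bar>t\<bar> < r" for t
  proof -
    have "((\<lambda>t. \<Sum>n. c n * t ^ n) has_field_derivative (\<Sum>n. diffs c n * t ^ n)) (at t)"
      by (rule termdiffs_strong'[of r]) (use t summable in auto)
    then have "(f has_field_derivative (\<Sum>n. diffs c n * t ^ n)) (at t)"
      by (rule has_field_derivative_transform_within_open[where S = "{-r<..<r}"])
        (use t Suc.prems in \<open>auto simp: sums_iff\<close>)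
    then have "deriv f t = (\<Sum>n. diffs c n * t ^ n)" by (rule DERIV_imp_deriv)
    moreover have "summable (\<lambda>n. diffs c n * t ^ n)"
      by (rule termdiff_converges[of _ r]) (use t summable in auto)
    ultimately show ?thesis by (simp add: summable_sums)
  qed
  from Suc.IH[OF this] have "(deriv ^^ Suc k) f 0 = fact k * diffs c k"
    by (simp add: funpow_Suc_right del: funpow.simps)
  then show ?case by (simp add: diffs_def mult_ac)
qed

text \<open>The extension of \<open>mid_symbol\<close> to complex \<open>t\<close>; its Taylor coefficients at 0 are the expansion coefficients of \<open>\<phi>\<close> in time.\<close>

definition mid_series :: "real \<Rightarrow> complex \<Rightarrow> complex" where
  "mid_series s t = complex_of_real (sinc s) *
     (inv_sqrt_sinc (t - complex_of_real s) * inv_sqrt_sinc (t + complex_of_real s))"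

text \<open>The radius \<open>3/2\<close> is not optimal. It is less than \<open>pi / 2\<close>, so that the arguments of \<open>F\<close> stay in a compact part of the disc of radius \<open>pi\<close>, and greater than 1, so that Cauchy's inequality can be used on the unit circle.\<close>

lemma mid_series_holomorphic:
  assumes "\<bar>s\<bar> < pi / 2"
  shows "mid_series s holomorphic_on ball 0 (3/2)"
  unfolding mid_series_def using assms pi_gt3
  by (intro holomorphic_on_mult holomorphic_on_const inv_sqrt_sinc_shift_holomorphic) auto

lemma mid_series_of_real:
  assumes "\<bar>t\<bar> < pi / 2" "\<bar>s\<bar> < pi / 2"
  shows "mid_series s (complex_of_real t) = complex_of_real (mid_symbol t s)"
  using mid_kernel_real[OF assms] by (simp add: mid_series_def mid_symbol_def mid_kernel_def)

lemma abs_sinc_le_1: "\<bar>sinc x\<bar> \<le> (1::real)"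
  using abs_sin_x_le_abs_x[of x] by (simp add: sinc_def divide_le_eq_1)

lemma phi_mid_real_series:
  assumes t: "\<bar>t\<bar> < 3 / 2"
  shows "(\<lambda>n. Re ((deriv ^^ n) (mid_series (arctan x)) 0 / fact n) * t ^ n) sums phi_mid t x"
proof -
  have t': "\<bar>t\<bar> < pi / 2" using t pi_gt3 by linarith
  have "(\<lambda>n. (deriv ^^ n) (mid_series (arctan x)) 0 / fact n * complex_of_real t ^ n) sums
      mid_series (arctan x) (complex_of_real t)"
    using holomorphic_power_series[OF mid_series_holomorphic[OF abs_arctan_less[of x]], of "complex_of_real t"] t
    by simp
  from sums_Re[OF this] have "(\<lambda>n. Re ((deriv ^^ n) (mid_series (arctan x)) 0 / fact n * complex_of_real t ^ n)) sums
      phi_mid t x"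
    by (simp add: mid_series_of_real[OF t' abs_arctan_less] phi_mid_eq[OF t'])
  moreover have "Re (z * complex_of_real t ^ n) = Re z * t ^ n" for z n
    by (simp flip: of_real_power)
  ultimately show ?thesis by (simp only:)
qed

lemma phi_coeff_eq: "phi_coeff n x = Re ((deriv ^^ n) (mid_series (arctan x)) 0 / fact n)"
  unfolding phi_coeff_def by (subst power_series_higher_deriv[of "3 / 2", OF _ phi_mid_real_series]) auto

lemma phi_coeff_sums:
  assumes "\<bar>t\<bar> < 3 / 2"
  shows "(\<lambda>n. phi_coeff n x * t ^ n) sums phi_mid t x"
  unfolding phi_coeff_eq by (rule phi_mid_real_series[OF assms])

text \<open>All arguments of \<open>F\<close> lie in the closed disc of radius \<open>3/2 + pi/2 < pi\<close>, independently of \<open>x\<close>. On the unit circle Cauchy's inequality then gives a bound that does not even depend on \<open>n\<close>.\<close>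

lemma phi_coeff_bounded: "bounded (range (phi_coeff n))"
proof -
  obtain B where B: "0 \<le> B" "\<And>z. norm z \<le> 3 / 2 + pi / 2 \<Longrightarrow> norm (inv_sqrt_sinc z) \<le> B"
    by (rule holomorphic_bounded_on_cball[OF inv_sqrt_sinc_holomorphic, of "3 / 2 + pi / 2"]) (use pi_gt3 that in auto)
  have "\<bar>phi_coeff n x\<bar> \<le> 1 * (B * B)" for x
  proof -
    define s where "s = arctan x"
    have s: "\<bar>s\<bar> < pi / 2" unfolding s_def by (rule abs_arctan_less)
    have "norm ((deriv ^^ n) (mid_series s) 0 / fact n) \<le> 1 * (B * B) / 1 ^ n"
    proof (rule taylor_coeff_bound[OF mid_series_holomorphic[OF s]])
      fix t :: complex assume t: "norm t < 3 / 2"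
      have "norm (t - complex_of_real s) \<le> 3 / 2 + pi / 2" "norm (t + complex_of_real s) \<le> 3 / 2 + pi / 2"
        using norm_triangle_ineq4[of t "complex_of_real s"] norm_triangle_ineq[of t "complex_of_real s"] t s
        by auto
      then show "norm (mid_series s t) \<le> 1 * (B * B)"
        unfolding mid_series_def norm_mult norm_of_real
        by (intro mult_mono abs_sinc_le_1 B mult_nonneg_nonneg norm_ge_zero) auto
    qed auto
    then show ?thesis
      using abs_Re_le_cmod[of "(deriv ^^ n) (mid_series s) 0 / fact n"]
      unfolding phi_coeff_eq s_def[symmetric] by simp
  qed
  then show ?thesis unfolding bounded_iff by auto
qed

section \<open>Square-integrable functions\<close>

lemma cmod_add_sq_le: "(cmod (a + b))\<^sup>2 \<le> 2 * (cmod a)\<^sup>2 + 2 * (cmod b)\<^sup>2"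
proof -
  have "(cmod (a + b))\<^sup>2 \<le> (cmod a + cmod b)\<^sup>2"
    by (intro power_mono norm_triangle_ineq) simp
  also have "\<dots> \<le> 2 * (cmod a)\<^sup>2 + 2 * (cmod b)\<^sup>2"
    using zero_le_power2[of "cmod a - cmod b"] by (simp add: power2_sum power2_diff)
  finally show ?thesis .
qed

definition square_integrable :: "'a measure \<Rightarrow> ('a \<Rightarrow> complex) \<Rightarrow> bool" where
  "square_integrable M u \<longleftrightarrow> u \<in> borel_measurable M \<and> integrable M (\<lambda>x. (cmod (u x))\<^sup>2)"

abbreviation norm_sq :: "'a measure \<Rightarrow> ('a \<Rightarrow> complex) \<Rightarrow> real" where
  "norm_sq M u \<equiv> (LINT x|M. (cmod (u x))\<^sup>2)"

lemma square_integrable_measurable [measurable_dest]: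
  "square_integrable M u \<Longrightarrow> u \<in> borel_measurable M"
  by (simp add: square_integrable_def)

lemma square_integrable_add:
  assumes "square_integrable M u" "square_integrable M v"
  shows "square_integrable M (\<lambda>x. u x + v x)"
proof -
  note [measurable] = assms[THEN square_integrable_measurable]
  have "integrable M (\<lambda>x. 2 * (cmod (u x))\<^sup>2 + 2 * (cmod (v x))\<^sup>2)"
    using assms by (simp add: square_integrable_def)
  then have "integrable M (\<lambda>x. (cmod (u x + v x))\<^sup>2)"
    by (rule Bochner_Integration.integrable_bound) (auto intro!: AE_I2 simp: cmod_add_sq_le)
  then show ?thesis by (simp add: square_integrable_def)
qed

lemma square_integrable_cmult:
  assumes "square_integrable M u"
  shows "square_integrable M (\<lambda>x. c * u x)"
  using assms by (auto simp: square_integrable_def norm_mult power_mult_distrib)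

lemma square_integrable_diff:
  assumes "square_integrable M u" "square_integrable M v"
  shows "square_integrable M (\<lambda>x. u x - v x)"
  using square_integrable_add[OF assms(1) square_integrable_cmult[OF assms(2), of "-1"]] by simp

lemma square_integrable_sum:
  assumes "finite I" "\<And>i. i \<in> I \<Longrightarrow> square_integrable M (u i)"
  shows "square_integrable M (\<lambda>x. \<Sum>i\<in>I. u i x)"
  using assms
  by (induction I rule: finite_induct) (auto simp: square_integrable_def[of _ "\<lambda>x. 0"] intro: square_integrable_add)

lemma square_integrable_mult_integrable:
  assumes "square_integrable M u" "square_integrable M v"
  shows "integrable M (\<lambda>x. u x * v x)"
proof -
  note [measurable] = assms[THEN square_integrable_measurable]
  have "integrable M (\<lambda>x. (cmod (u x))\<^sup>2 + (cmod (v x))\<^sup>2)"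
    using assms by (simp add: square_integrable_def)
  moreover have "norm (u x * v x) \<le> (cmod (u x))\<^sup>2 + (cmod (v x))\<^sup>2" for x
  proof -
    have "2 * (cmod (u x) * cmod (v x)) \<le> (cmod (u x))\<^sup>2 + (cmod (v x))\<^sup>2"
      using sum_squares_bound[of "cmod (u x)" "cmod (v x)"] by simp
    moreover have "0 \<le> cmod (u x) * cmod (v x)" by simp
    ultimately show ?thesis unfolding norm_mult by linarith
  qed
  ultimately show ?thesis by (rule_tac Bochner_Integration.integrable_bound) auto
qed

lemma norm_sq_add_le:
  assumes "square_integrable M u" "square_integrable M v"
  shows "norm_sq M (\<lambda>x. u x + v x) \<le> 2 * norm_sq M u + 2 * norm_sq M v"
proof -
  have "norm_sq M (\<lambda>x. u x + v x) \<le> (LINT x|M. 2 * (cmod (u x))\<^sup>2 + 2 * (cmod (v x))\<^sup>2)"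
    using square_integrable_add[OF assms] assms
    by (intro integral_mono cmod_add_sq_le) (auto simp: square_integrable_def)
  also have "\<dots> = 2 * norm_sq M u + 2 * norm_sq M v"
    using assms by (simp add: square_integrable_def)
  finally show ?thesis .
qed

lemma norm_sq_eq_0_AE:
  assumes "square_integrable M u" "norm_sq M u = 0"
  shows "AE x in M. u x = 0"
  using assms integral_nonneg_eq_0_iff_AE[of M "\<lambda>x. (cmod (u x))\<^sup>2"] by (simp add: square_integrable_def)

text \<open>The weight \<open>k\<close> replaces the Cauchy-Schwarz inequality in the comparison of first and second moments: small second moments are multiplied by a large \<open>k\<close>.\<close>

lemma le_square_plus_inverse:
  fixes a k :: real
  assumes "0 < k"
  shows "a \<le> k * a\<^sup>2 + 1 / k"
proof -
  have "0 \<le> (k * a - 1)\<^sup>2 + k * a" if "0 \<le> a" using that assms by simp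
  then have "a * k \<le> (k * a\<^sup>2 + 1 / k) * k" if "0 \<le> a"
    using that assms by (simp add: power2_eq_square algebra_simps)
  then show ?thesis
    using assms by (cases "0 \<le> a") (auto simp: mult_le_cancel_right intro: order_trans[of a 0])
qed

lemma (in finite_measure) L1_le_L2:
  fixes d :: "'a \<Rightarrow> complex"
  assumes d: "square_integrable M d" and k: "0 < k"
  shows "integrable M (\<lambda>x. cmod (d x))"
    and "(LINT x|M. cmod (d x)) \<le> k * norm_sq M d + measure M (space M) / k"
proof -
  have int: "integrable M (\<lambda>x. k * (cmod (d x))\<^sup>2 + 1 / k)"
    using d by (simp add: square_integrable_def)
  then show i: "integrable M (\<lambda>x. cmod (d x))"
    by (rule Bochner_Integration.integrable_bound)
      (use d le_square_plus_inverse[OF k] k in \<open>auto simp: square_integrable_def intro!: AE_I2\<close>)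
  have "(LINT x|M. cmod (d x)) \<le> (LINT x|M. k * (cmod (d x))\<^sup>2 + 1 / k)"
    by (intro integral_mono i int le_square_plus_inverse k)
  also have "\<dots> = k * norm_sq M d + measure M (space M) / k"
    using d by (simp add: square_integrable_def)
  finally show "(LINT x|M. cmod (d x)) \<le> k * norm_sq M d + measure M (space M) / k" .
qed

text \<open>By monotone convergence the sum of the absolute values has a finite integral, hence is finite almost everywhere.\<close>

lemma AE_summable_of_L1:
  fixes d :: "nat \<Rightarrow> 'a \<Rightarrow> complex"
  assumes int: "\<And>j. integrable M (\<lambda>x. cmod (d j x))"
    and sum: "summable (\<lambda>j. LINT x|M. cmod (d j x))"
  shows "AE x in M. summable (\<lambda>j. cmod (d j x))"
proof -
  note [measurable] = int[THEN borel_measurable_integrable]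
  have "(\<integral>\<^sup>+ x. (\<Sum>j. ennreal (cmod (d j x))) \<partial>M) = (\<Sum>j. \<integral>\<^sup>+ x. ennreal (cmod (d j x)) \<partial>M)"
    by (rule nn_integral_suminf) measurable
  also have "\<dots> = (\<Sum>j. ennreal (LINT x|M. cmod (d j x)))"
    by (intro suminf_cong nn_integral_eq_integral int AE_I2) simp
  also have "\<dots> = ennreal (\<Sum>j. LINT x|M. cmod (d j x))"
    by (intro suminf_ennreal2 sum integral_nonneg_AE AE_I2) simp
  finally have "(\<integral>\<^sup>+ x. (\<Sum>j. ennreal (cmod (d j x))) \<partial>M) \<noteq> \<infinity>" by simp
  then have "AE x in M. (\<Sum>j. ennreal (cmod (d j x))) \<noteq> \<infinity>"
    by (intro nn_integral_PInf_AE) measurable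
  then show ?thesis
    by eventually_elim (auto intro: summable_suminf_not_top)
qed

text \<open>The Riesz-Fischer theorem for finite measures. Along a subsequence with increments of order \<open>2 ^ (-j)\<close> the functions converge almost everywhere, and Fatou's lemma shows that the pointwise limit is also the limit in the mean.\<close>

lemma (in finite_measure) L2_complete:
  fixes u :: "nat \<Rightarrow> 'a \<Rightarrow> complex"
  assumes sq: "\<And>n. square_integrable M (u n)"
    and cauchy: "\<And>e. e > 0 \<Longrightarrow> \<exists>N. \<forall>m\<ge>N. \<forall>n\<ge>N. norm_sq M (\<lambda>x. u m x - u n x) < e"
  shows "\<exists>v. square_integrable M v \<and> (\<lambda>n. norm_sq M (\<lambda>x. v x - u n x)) \<longlonglongrightarrow> 0"
proof -
  note [measurable] = sq[THEN square_integrable_measurable]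
  have "\<exists>N. \<forall>j::nat. \<forall>m\<ge>N j. \<forall>n\<ge>N j. norm_sq M (\<lambda>x. u m x - u n x) < (1/4) ^ j"
    using cauchy[of "(1/4) ^ j" for j] by (intro choice) simp
  then obtain N :: "nat \<Rightarrow> nat" where
    N: "\<And>j m n. m \<ge> N j \<Longrightarrow> n \<ge> N j \<Longrightarrow> norm_sq M (\<lambda>x. u m x - u n x) < (1/4) ^ j" by blast
  \<comment> \<open>A sum rather than a maximum: \<open>r j\<close> dominates \<open>N j\<close> and \<open>j\<close>, and \<open>r (Suc j)\<close> still dominates \<open>N j\<close>.\<close>
  define r where "r j = (\<Sum>i\<le>j. N i) + j" for j
  have r: "N j \<le> r j" "N j \<le> r (Suc j)" "j \<le> r j" for j
  proof -
    have "N j \<le> (\<Sum>i\<le>j. N i)" by (intro member_le_sum) auto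
    then show "N j \<le> r j" "N j \<le> r (Suc j)" "j \<le> r j" by (auto simp: r_def)
  qed
  define d where "d j x = u (r (Suc j)) x - u (r j) x" for j x
  have dsq: "square_integrable M (d j)" for j
    unfolding d_def by (intro square_integrable_diff sq)
  define \<mu> where "\<mu> = measure M (space M)"
  have dint: "integrable M (\<lambda>x. cmod (d j x))" for j
    by (rule L1_le_L2[OF dsq, of 1]) simp
  have dle: "(LINT x|M. cmod (d j x)) \<le> (1 + \<mu>) * (1/2) ^ j" for j
  proof -
    have "(LINT x|M. cmod (d j x)) \<le> 2 ^ j * norm_sq M (d j) + \<mu> / 2 ^ j"
      unfolding \<mu>_def by (rule L1_le_L2[OF dsq]) simp
    also have "\<dots> \<le> 2 ^ j * (1/4) ^ j + \<mu> / 2 ^ j"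
      using N[OF r(2)[of j] r(1)[of j]] by (intro add_mono mult_left_mono) (auto simp: d_def)
    also have "(2::real) ^ j * (1/4) ^ j = (1/2) ^ j" by (simp flip: power_mult_distrib)
    finally show ?thesis by (simp add: power_divide field_simps)
  qed
  have "summable (\<lambda>j. LINT x|M. cmod (d j x))"
  proof (rule summable_comparison_test')
    show "summable (\<lambda>j. (1 + \<mu>) * (1/2::real) ^ j)" by (intro summable_mult summable_geometric) simp
    show "norm (LINT x|M. cmod (d j x)) \<le> (1 + \<mu>) * (1/2) ^ j" if "j \<ge> 0" for j
      using dle[of j] by simp
  qed
  from AE_summable_of_L1[OF dint this]
  have conv: "AE x in M. (\<lambda>j. u (r j) x) \<longlonglongrightarrow> lim (\<lambda>j. u (r j) x)"
  proof eventually_elim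
    case (elim x)
    then have "summable (\<lambda>j. d j x)" by (rule summable_norm_cancel)
    then have "(\<lambda>j. u (r 0) x + (\<Sum>i<j. d i x)) \<longlonglongrightarrow> u (r 0) x + (\<Sum>i. d i x)"
      by (intro tendsto_intros summable_LIMSEQ)
    moreover have "u (r 0) x + (\<Sum>i<j. d i x) = u (r j) x" for j
      using sum_lessThan_telescope[of "\<lambda>j. u (r j) x" j] by (simp add: d_def)
    ultimately have "convergent (\<lambda>j. u (r j) x)" by (auto simp: convergent_def)
    then show ?case by (simp add: convergent_LIMSEQ_iff)
  qed
  define v where "v x = lim (\<lambda>j. u (r j) x)" for x
  have [measurable]: "v \<in> borel_measurable M" unfolding v_def by measurable
  have fatou: "square_integrable M (\<lambda>x. v x - u n x) \<and> norm_sq M (\<lambda>x. v x - u n x) \<le> e"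
    if e: "e > 0" and n: "\<And>m. m \<ge> K \<Longrightarrow> norm_sq M (\<lambda>x. u m x - u n x) < e" for e n K
  proof -
    have diffs: "integrable M (\<lambda>x. (cmod (u m x - u n x))\<^sup>2)" for m
      using square_integrable_diff[OF sq sq, of m n] by (simp add: square_integrable_def)
    have "(\<integral>\<^sup>+ x. ennreal ((cmod (v x - u n x))\<^sup>2) \<partial>M) =
        (\<integral>\<^sup>+ x. liminf (\<lambda>j. ennreal ((cmod (u (r j) x - u n x))\<^sup>2)) \<partial>M)"
    proof (rule nn_integral_cong_AE)
      show "AE x in M. ennreal ((cmod (v x - u n x))\<^sup>2) = liminf (\<lambda>j. ennreal ((cmod (u (r j) x - u n x))\<^sup>2))"
        using conv
      proof eventually_elim
        case (elim x)
        then have "(\<lambda>j. ennreal ((cmod (u (r j) x - u n x))\<^sup>2)) \<longlonglongrightarrow> ennreal ((cmod (v x - u n x))\<^sup>2)"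
          unfolding v_def by (intro tendsto_ennrealI tendsto_intros)
        then show ?case by (rule lim_imp_Liminf[OF trivial_limit_sequentially, symmetric])
      qed
    qed
    also have "\<dots> \<le> liminf (\<lambda>j. \<integral>\<^sup>+ x. ennreal ((cmod (u (r j) x - u n x))\<^sup>2) \<partial>M)"
      by (rule nn_integral_liminf) measurable
    also have "\<dots> \<le> ennreal e"
    proof (rule Liminf_le)
      show "\<forall>\<^sub>F j in sequentially. (\<integral>\<^sup>+ x. ennreal ((cmod (u (r j) x - u n x))\<^sup>2) \<partial>M) \<le> ennreal e"
        using eventually_ge_at_top[of K]
      proof eventually_elim
        case (elim j)
        then have "norm_sq M (\<lambda>x. u (r j) x - u n x) < e" using r(3)[of j] by (intro n) simp
        then show ?case
          by (subst nn_integral_eq_integral[OF diffs]) (auto intro: ennreal_leI less_imp_le)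
      qed
    qed simp
    finally have le: "(\<integral>\<^sup>+ x. ennreal ((cmod (v x - u n x))\<^sup>2) \<partial>M) \<le> ennreal e" .
    then have "(\<integral>\<^sup>+ x. ennreal ((cmod (v x - u n x))\<^sup>2) \<partial>M) < \<infinity>"
      using le_less_trans[OF le ennreal_less_top] by simp
    then have int: "integrable M (\<lambda>x. (cmod (v x - u n x))\<^sup>2)"
      by (intro integrableI_bounded) auto
    then have "ennreal (norm_sq M (\<lambda>x. v x - u n x)) \<le> ennreal e"
      using le by (subst nn_integral_eq_integral[symmetric]) auto
    with e int show ?thesis by (simp add: square_integrable_def ennreal_le_iff)
  qed
  have lim: "(\<lambda>n. norm_sq M (\<lambda>x. v x - u n x)) \<longlonglongrightarrow> 0"
  proof (rule LIMSEQ_I)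
    fix e :: real assume "e > 0"
    then have e2: "e / 2 > 0" by simp
    then obtain K where K: "\<And>m n. m \<ge> K \<Longrightarrow> n \<ge> K \<Longrightarrow> norm_sq M (\<lambda>x. u m x - u n x) < e / 2"
      using cauchy[OF e2] by blast
    have "norm (norm_sq M (\<lambda>x. v x - u n x) - 0) < e" if "n \<ge> K" for n
    proof -
      have "norm_sq M (\<lambda>x. v x - u n x) \<le> e / 2"
        using fatou[OF e2 K[OF _ that]] by blast
      then show ?thesis using \<open>e > 0\<close> by simp
    qed
    then show "\<exists>K. \<forall>n\<ge>K. norm (norm_sq M (\<lambda>x. v x - u n x) - 0) < e" by blast
  qed
  obtain K where K: "\<And>m n. m \<ge> K \<Longrightarrow> n \<ge> K \<Longrightarrow> norm_sq M (\<lambda>x. u m x - u n x) < 1"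
    using cauchy[of 1] by auto
  have "square_integrable M (\<lambda>x. v x - u K x)"
    using fatou[of 1 K K] K[of _ K] by simp
  from square_integrable_add[OF this sq[of K]] have "square_integrable M v" by simp
  with lim show ?thesis by blast
qed

section \<open>Bounded Fourier multipliers on the circle\<close>

abbreviation mode :: "real \<Rightarrow> int \<Rightarrow> real \<Rightarrow> complex" where
  "mode L k x \<equiv> cis (wavenumber L k * x)"

definition trig_sum :: "real \<Rightarrow> int set \<Rightarrow> (int \<Rightarrow> complex) \<Rightarrow> real \<Rightarrow> complex" where
  "trig_sum L S c x = (\<Sum>k\<in>S. c k * mode L k x)"

lemma L2_circle_iff: "u \<in> L2_circle L \<longleftrightarrow> square_integrable (circle_measure L) u"
  by (simp add: L2_circle_def square_integrable_def)

lemma L2_norm_circle_norm_sq: "L2_norm_circle L u = sqrt (norm_sq (circle_measure L) u)"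
  by (simp add: L2_norm_circle_def)

lemma finite_measure_circle: "finite_measure (circle_measure L)"
  by (intro finite_measure_lebesgue_on bounded_set_imp_lmeasurable bounded_subset[OF bounded_closed_interval[of 0 L]])
    auto

lemma mode_measurable [measurable]: "mode L k \<in> borel_measurable (circle_measure L)"
  by (rule continuous_imp_measurable_on_sets_lebesgue) (auto intro!: continuous_intros)

lemma square_integrable_mode: "square_integrable (circle_measure L) (mode L k)"
proof -
  interpret finite_measure "circle_measure L" by (rule finite_measure_circle)
  show ?thesis using mode_measurable by (simp add: square_integrable_def)
qed

lemma cnj_mode: "cnj (mode L k x) = mode L (- k) x"
  by (simp add: cis_cnj wavenumber_def)

lemma mode_mult: "mode L k x * mode L l x = mode L (k + l) x"
  by (simp add: cis_mult wavenumber_def algebra_simps add_divide_distrib)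

text \<open>The primitive \<open>cis (\<kappa> x) / (\<i> \<kappa>)\<close> takes the same value at both ends of the interval, which is closed up by a null set for the fundamental theorem.\<close>

lemma integral_mode:
  assumes L: "L > 0"
  shows "(LINT x|circle_measure L. mode L k x) = (if k = 0 then complex_of_real L else 0)"
proof -
  interpret finite_measure "circle_measure L" by (rule finite_measure_circle)
  have int: "integrable (circle_measure L) (mode L k)"
    by (rule integrable_const_bound[of _ 1]) (auto simp: mode_measurable)
  have "(LINT x|circle_measure L. mode L k x) = integral {0..<L} (mode L k)"
    by (rule lebesgue_integral_eq_integral[OF int]) simp
  also have "\<dots> = integral {0..L} (mode L k)"
    by (rule integral_spike_set) (auto intro: negligible_subset[of "{L}"])
  also have "\<dots> = (if k = 0 then complex_of_real L else 0)"
  proof (cases "k = 0")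
    case True
    then show ?thesis using L by (simp add: wavenumber_def scaleR_conv_of_real)
  next
    case False
    define \<kappa> where "\<kappa> = wavenumber L k"
    have \<kappa>: "\<kappa> \<noteq> 0" using False L by (simp add: \<kappa>_def wavenumber_def)
    have "((\<lambda>x. cis (\<kappa> * x)) has_integral
        (cis (\<kappa> * L) / (\<i> * complex_of_real \<kappa>) - cis (\<kappa> * 0) / (\<i> * complex_of_real \<kappa>))) {0..L}"
    proof (rule fundamental_theorem_of_calculus)
      fix x
      have "((\<lambda>x. cis (\<kappa> * x)) has_vector_derivative (\<kappa> *\<^sub>R (\<i> * cis (\<kappa> * x)))) (at x within {0..L})"
        unfolding has_vector_derivative_def
        by (rule has_derivative_eq_rhs[OF has_derivative_cis[OF has_derivative_mult_right[OF has_derivative_ident]]])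
          (simp add: mult_ac)
      from has_vector_derivative_divide[OF this, of "\<i> * complex_of_real \<kappa>"]
      show "((\<lambda>x. cis (\<kappa> * x) / (\<i> * complex_of_real \<kappa>)) has_vector_derivative cis (\<kappa> * x)) (at x within {0..L})"
        using \<kappa> by (simp add: scaleR_conv_of_real field_simps)
    qed (use L in simp)
    moreover have "cis (\<kappa> * L) = 1"
    proof -
      have "\<kappa> * L = 2 * pi * of_int k" using L by (simp add: \<kappa>_def wavenumber_def)
      then show ?thesis using cis_multiple_2pi[of "of_int k"] by (simp add: mult_ac)
    qed
    ultimately have "((\<lambda>x. cis (\<kappa> * x)) has_integral 0) {0..L}" by simp
    with False show ?thesis unfolding \<kappa>_def by (simp add: integral_unique)
  qed
  finally show ?thesis .
qed

lemma square_integrable_trig_sum: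
  "finite S \<Longrightarrow> square_integrable (circle_measure L) (trig_sum L S c)"
  unfolding trig_sum_def
  by (intro square_integrable_sum square_integrable_cmult square_integrable_mode)

lemma fourier_coeff_mode:
  "L > 0 \<Longrightarrow> (LINT x|circle_measure L. u x * mode L (- k) x) = complex_of_real L * fourier_coeff L u k"
  by (simp add: fourier_coeff_def wavenumber_def)

lemma fourier_coeff_trig_sum:
  assumes L: "L > 0" and S: "finite S" "l \<in> S"
  shows "fourier_coeff L (trig_sum L S c) l = c l"
proof -
  have "complex_of_real L * fourier_coeff L (trig_sum L S c) l =
      (LINT x|circle_measure L. (\<Sum>k\<in>S. c k * mode L (k + - l) x))"
    unfolding fourier_coeff_mode[OF L, symmetric] trig_sum_def sum_distrib_right mult.assoc mode_mult ..
  also have "\<dots> = (\<Sum>k\<in>S. LINT x|circle_measure L. c k * mode L (k + - l) x)"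
  proof (rule Bochner_Integration.integral_sum)
    fix k
    interpret finite_measure "circle_measure L" by (rule finite_measure_circle)
    have "integrable (circle_measure L) (mode L (k + - l))"
      by (rule integrable_const_bound[of _ 1]) (auto simp: mode_measurable)
    then show "integrable (circle_measure L) (\<lambda>x. c k * mode L (k + - l) x)" by (rule integrable_mult_right)
  qed
  also have "\<dots> = (\<Sum>k\<in>S. if k = l then c k * complex_of_real L else 0)"
    by (intro sum.cong refl) (simp add: integral_mode[OF L] del: cis_mult)
  also have "\<dots> = complex_of_real L * c l" using S by simp
  finally show ?thesis using L by simp
qed

lemma inner_trig_sum:
  assumes L: "L > 0" and S: "finite S" and u: "square_integrable (circle_measure L) u"
  shows "(LINT x|circle_measure L. u x * cnj (trig_sum L S c x)) =
     complex_of_real L * (\<Sum>k\<in>S. fourier_coeff L u k * cnj (c k))"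
proof -
  have int: "integrable (circle_measure L) (\<lambda>x. u x * mode L (- k) x)" for k
    by (rule square_integrable_mult_integrable[OF u square_integrable_mode])
  have "(LINT x|circle_measure L. u x * cnj (trig_sum L S c x)) =
      (LINT x|circle_measure L. (\<Sum>k\<in>S. cnj (c k) * (u x * mode L (- k) x)))"
    unfolding trig_sum_def cnj_sum complex_cnj_mult cnj_mode sum_distrib_left
    by (simp only: mult.left_commute)
  also have "\<dots> = (\<Sum>k\<in>S. LINT x|circle_measure L. cnj (c k) * (u x * mode L (- k) x))"
    by (intro Bochner_Integration.integral_sum integrable_mult_right int)
  also have "\<dots> = (\<Sum>k\<in>S. cnj (c k) * (complex_of_real L * fourier_coeff L u k))"
    by (simp add: int fourier_coeff_mode[OF L])
  finally show ?thesis by (simp add: sum_distrib_left mult_ac)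
qed

lemma complex_norm_square_integral:
  "complex_of_real (norm_sq M u) = (LINT x|M. u x * cnj (u x))"
  by (simp only: complex_norm_square[symmetric] integral_complex_of_real)

lemma norm_sq_trig_sum:
  assumes L: "L > 0" and S: "finite S"
  shows "norm_sq (circle_measure L) (trig_sum L S c) = L * (\<Sum>k\<in>S. (cmod (c k))\<^sup>2)"
proof -
  have "complex_of_real (norm_sq (circle_measure L) (trig_sum L S c)) =
      complex_of_real L * (\<Sum>k\<in>S. fourier_coeff L (trig_sum L S c) k * cnj (c k))"
    unfolding complex_norm_square_integral
    by (rule inner_trig_sum[OF L S square_integrable_trig_sum[OF S]])
  also have "\<dots> = complex_of_real (L * (\<Sum>k\<in>S. (cmod (c k))\<^sup>2))"
    by (simp add: fourier_coeff_trig_sum[OF L S] complex_norm_square del: of_real_power)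
  finally show ?thesis by (simp only: of_real_eq_iff)
qed

lemma cmod_diff_square: "(cmod (a - b))\<^sup>2 = (cmod a)\<^sup>2 - 2 * Re (a * cnj b) + (cmod b)\<^sup>2"
  by (simp add: cmod_power2) (simp add: power2_eq_square algebra_simps)

text \<open>Expand the nonnegative squared distance between \<open>u\<close> and its partial Fourier sum.\<close>

lemma bessel:
  assumes L: "L > 0" and S: "finite S" and u: "square_integrable (circle_measure L) u"
  shows "L * (\<Sum>k\<in>S. (cmod (fourier_coeff L u k))\<^sup>2) \<le> norm_sq (circle_measure L) u"
proof -
  let ?M = "circle_measure L" and ?c = "fourier_coeff L u"
  let ?T = "trig_sum L S ?c"
  have T: "square_integrable ?M ?T" by (rule square_integrable_trig_sum[OF S])
  have cnjT: "square_integrable ?M (\<lambda>x. cnj (?T x))"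
    using T by (auto simp: square_integrable_def
        intro: measurable_compose[OF _ borel_measurable_continuous_onI[OF continuous_on_cnj[OF continuous_on_id]]])
  have int: "integrable ?M (\<lambda>x. u x * cnj (?T x))"
    by (rule square_integrable_mult_integrable[OF u cnjT])
  define R where "R x = Re (u x * cnj (?T x))" for x
  have intR: "integrable ?M R"
    unfolding R_def by (rule integrable_Re[OF int])
  have sq: "(cmod (u x - ?T x))\<^sup>2 = (cmod (u x))\<^sup>2 - 2 * R x + (cmod (?T x))\<^sup>2" for x
    unfolding R_def by (rule cmod_diff_square)
  have "(LINT x|?M. R x) = L * (\<Sum>k\<in>S. (cmod (?c k))\<^sup>2)"
  proof -
    have "(LINT x|?M. Re (u x * cnj (?T x))) = Re (LINT x|?M. u x * cnj (?T x))"
      by (rule integral_Re[OF int])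
    also have "\<dots> = Re (complex_of_real (L * (\<Sum>k\<in>S. (cmod (?c k))\<^sup>2)))"
      unfolding inner_trig_sum[OF L S u] by (simp add: complex_norm_square[symmetric] del: of_real_power flip: of_real_sum)
    finally show ?thesis unfolding R_def Re_complex_of_real .
  qed
  moreover have "0 \<le> norm_sq ?M (\<lambda>x. u x - ?T x)" by simp
  moreover have "norm_sq ?M (\<lambda>x. u x - ?T x) =
      norm_sq ?M u - 2 * (LINT x|?M. R x) + norm_sq ?M ?T"
    unfolding sq using u T intR by (simp add: square_integrable_def)
  ultimately show ?thesis using norm_sq_trig_sum[OF L S, of ?c] by simp
qed

lemma fourier_coeff_add:
  assumes "L > 0" "square_integrable (circle_measure L) u" "square_integrable (circle_measure L) v"
  shows "fourier_coeff L (\<lambda>x. u x + v x) k = fourier_coeff L u k + fourier_coeff L v k"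
proof -
  have int: "integrable (circle_measure L) (\<lambda>x. w x * mode L (- k) x)"
    if "square_integrable (circle_measure L) w" for w
    by (rule square_integrable_mult_integrable[OF that square_integrable_mode])
  have "complex_of_real L * fourier_coeff L (\<lambda>x. u x + v x) k =
      complex_of_real L * (fourier_coeff L u k + fourier_coeff L v k)"
    unfolding distrib_left fourier_coeff_mode[OF assms(1), symmetric] distrib_right
    by (rule Bochner_Integration.integral_add) (intro int assms)+
  then show ?thesis using assms(1) by simp
qed

lemma fourier_coeff_cmult: "fourier_coeff L (\<lambda>x. c * u x) k = c * fourier_coeff L u k"
  by (simp add: fourier_coeff_def mult.assoc)

definition multiplier_sum :: "real \<Rightarrow> (int \<Rightarrow> complex) \<Rightarrow> (real \<Rightarrow> complex) \<Rightarrow> nat \<Rightarrow> real \<Rightarrow> complex" where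
  "multiplier_sum L m u K = trig_sum L {- int K..int K} (\<lambda>k. m k * fourier_coeff L u k)"

text \<open>Being the image of \<open>u\<close> under the multiplier with symbol \<open>m\<close>, as a relation: the image is determined only up to null sets.\<close>

definition multiplies :: "real \<Rightarrow> (int \<Rightarrow> complex) \<Rightarrow> (real \<Rightarrow> complex) \<Rightarrow> (real \<Rightarrow> complex) \<Rightarrow> bool" where
  "multiplies L m u v \<longleftrightarrow> square_integrable (circle_measure L) v \<and>
     (\<lambda>K. norm_sq (circle_measure L) (\<lambda>x. v x - multiplier_sum L m u K x)) \<longlonglongrightarrow> 0"

lemma square_integrable_multiplier_sum: "square_integrable (circle_measure L) (multiplier_sum L m u K)"
  unfolding multiplier_sum_def by (rule square_integrable_trig_sum) simp

lemma multiplier_sum_bound: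
  assumes L: "L > 0" and u: "square_integrable (circle_measure L) u" and m: "\<And>k. cmod (m k) \<le> B"
    and S: "finite S"
  shows "norm_sq (circle_measure L) (trig_sum L S (\<lambda>k. m k * fourier_coeff L u k)) \<le>
     B\<^sup>2 * norm_sq (circle_measure L) u"
proof -
  have "norm_sq (circle_measure L) (trig_sum L S (\<lambda>k. m k * fourier_coeff L u k)) =
      L * (\<Sum>k\<in>S. (cmod (m k))\<^sup>2 * (cmod (fourier_coeff L u k))\<^sup>2)"
    by (simp add: norm_sq_trig_sum[OF L S] norm_mult power_mult_distrib)
  also have "\<dots> \<le> L * (\<Sum>k\<in>S. B\<^sup>2 * (cmod (fourier_coeff L u k))\<^sup>2)"
    using L m by (intro mult_left_mono sum_mono mult_right_mono power_mono) auto
  also have "\<dots> = B\<^sup>2 * (L * (\<Sum>k\<in>S. (cmod (fourier_coeff L u k))\<^sup>2))"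
    by (simp add: sum_distrib_left mult_ac)
  also have "\<dots> \<le> B\<^sup>2 * norm_sq (circle_measure L) u"
    by (intro mult_left_mono bessel[OF L S u]) simp
  finally show ?thesis .
qed

text \<open>The partial sums of the squared coefficients increase and are bounded by Bessel's inequality; their differences are, up to the factor \<open>L\<close>, the squared distances of the partial Fourier sums.\<close>

lemma multiplies_exists:
  assumes L: "L > 0" and u: "square_integrable (circle_measure L) u" and m: "\<And>k. cmod (m k) \<le> B"
  shows "\<exists>v. multiplies L m u v"
proof -
  interpret finite_measure "circle_measure L" by (rule finite_measure_circle)
  define c where "c k = m k * fourier_coeff L u k" for k
  define \<sigma> where "\<sigma> K = (\<Sum>k\<in>{- int K..int K}. (cmod (c k))\<^sup>2)" for K
  have diff: "norm_sq (circle_measure L) (\<lambda>x. multiplier_sum L m u p x - multiplier_sum L m u q x) =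
      L * (\<sigma> p - \<sigma> q)" if "q \<le> p" for p q
  proof -
    have sub: "{- int q..int q} \<subseteq> {- int p..int p}" using that by auto
    have "multiplier_sum L m u p x - multiplier_sum L m u q x =
        trig_sum L ({- int p..int p} - {- int q..int q}) c x" for x
      unfolding multiplier_sum_def trig_sum_def c_def by (subst sum_diff[OF _ sub]) auto
    then show ?thesis
      by (simp add: norm_sq_trig_sum[OF L] \<sigma>_def sum_diff[OF _ sub])
  qed
  have "incseq \<sigma>"
    unfolding \<sigma>_def by (intro monoI sum_mono2) auto
  moreover have "\<sigma> K \<le> B\<^sup>2 * norm_sq (circle_measure L) u / L" for K
    using multiplier_sum_bound[OF L u m, of "{- int K..int K}"] L
    by (simp add: norm_sq_trig_sum[OF L] \<sigma>_def c_def field_simps)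
  ultimately have "Cauchy \<sigma>"
    by (rule_tac incseq_convergent[of \<sigma> "B\<^sup>2 * norm_sq (circle_measure L) u / L"]) (auto intro: LIMSEQ_imp_Cauchy)
  have "\<exists>v. square_integrable (circle_measure L) v \<and>
      (\<lambda>K. norm_sq (circle_measure L) (\<lambda>x. v x - multiplier_sum L m u K x)) \<longlonglongrightarrow> 0"
  proof (rule L2_complete[OF square_integrable_multiplier_sum])
    fix e :: real assume "e > 0"
    then have "e / L > 0" using L by simp
    then obtain N where N: "\<And>p q. p \<ge> N \<Longrightarrow> q \<ge> N \<Longrightarrow> dist (\<sigma> p) (\<sigma> q) < e / L"
      using metric_CauchyD[OF \<open>Cauchy \<sigma>\<close>] by blast
    have "norm_sq (circle_measure L) (\<lambda>x. multiplier_sum L m u p x - multiplier_sum L m u q x) < e"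
      if "p \<ge> N" "q \<ge> N" for p q
    proof -
      have "norm_sq (circle_measure L) (\<lambda>x. multiplier_sum L m u p x - multiplier_sum L m u q x) =
          L * \<bar>\<sigma> p - \<sigma> q\<bar>"
      proof (cases "q \<le> p")
        case True
        with \<open>incseq \<sigma>\<close> show ?thesis by (simp add: diff incseqD)
      next
        case False
        then have "norm_sq (circle_measure L) (\<lambda>x. multiplier_sum L m u q x - multiplier_sum L m u p x) =
            L * (\<sigma> q - \<sigma> p)" by (intro diff) simp
        moreover have "\<sigma> p \<le> \<sigma> q" using False by (intro incseqD[OF \<open>incseq \<sigma>\<close>]) simp
        moreover have "norm_sq (circle_measure L) (\<lambda>x. multiplier_sum L m u p x - multiplier_sum L m u q x) =
            norm_sq (circle_measure L) (\<lambda>x. multiplier_sum L m u q x - multiplier_sum L m u p x)"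
          by (subst norm_minus_commute) (rule refl)
        ultimately show ?thesis by simp
      qed
      also have "\<dots> < e" using N[OF that] L by (simp add: dist_real_def pos_less_divide_eq mult.commute)
      finally show ?thesis .
    qed
    then show "\<exists>N. \<forall>p\<ge>N. \<forall>q\<ge>N.
        norm_sq (circle_measure L) (\<lambda>x. multiplier_sum L m u p x - multiplier_sum L m u q x) < e" by blast
  qed
  then show ?thesis by (simp add: multiplies_def)
qed

text \<open>The factor 2 stems from using \<open>\<bar>a + b\<bar>\<^sup>2 \<le> 2 \<bar>a\<bar>\<^sup>2 + 2 \<bar>b\<bar>\<^sup>2\<close> in place of the triangle inequality of the norm; it does no harm to boundedness.\<close>

lemma multiplies_norm_bound:
  assumes L: "L > 0" and u: "square_integrable (circle_measure L) u" and m: "\<And>k. cmod (m k) \<le> B"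
    and v: "multiplies L m u v"
  shows "norm_sq (circle_measure L) v \<le> 2 * B\<^sup>2 * norm_sq (circle_measure L) u"
proof (rule LIMSEQ_le_const)
  let ?M = "circle_measure L" and ?s = "multiplier_sum L m u"
  have sv: "square_integrable ?M v" using v by (simp add: multiplies_def)
  have "(\<lambda>K. 2 * norm_sq ?M (\<lambda>x. v x - ?s K x) + 2 * (B\<^sup>2 * norm_sq ?M u)) \<longlonglongrightarrow> 2 * 0 + 2 * (B\<^sup>2 * norm_sq ?M u)"
    using v by (intro tendsto_intros) (simp add: multiplies_def)
  then show "(\<lambda>K. 2 * norm_sq ?M (\<lambda>x. v x - ?s K x) + 2 * (B\<^sup>2 * norm_sq ?M u)) \<longlonglongrightarrow> 2 * B\<^sup>2 * norm_sq ?M u"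
    by (simp add: mult.assoc)
  have "norm_sq ?M v \<le> 2 * norm_sq ?M (\<lambda>x. v x - ?s K x) + 2 * (B\<^sup>2 * norm_sq ?M u)" for K
  proof -
    have "norm_sq ?M (\<lambda>x. (v x - ?s K x) + ?s K x) \<le> 2 * norm_sq ?M (\<lambda>x. v x - ?s K x) + 2 * norm_sq ?M (?s K)"
      by (intro norm_sq_add_le square_integrable_diff sv square_integrable_multiplier_sum)
    moreover have "norm_sq ?M (?s K) \<le> B\<^sup>2 * norm_sq ?M u"
      unfolding multiplier_sum_def by (rule multiplier_sum_bound[OF L u m]) simp
    ultimately show ?thesis by simp
  qed
  then show "\<exists>N. \<forall>K\<ge>N. norm_sq ?M v \<le> 2 * norm_sq ?M (\<lambda>x. v x - ?s K x) + 2 * (B\<^sup>2 * norm_sq ?M u)" by blast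
qed

lemma AE_eq_of_approx:
  assumes s: "\<And>K. square_integrable M (s K)"
    and v: "square_integrable M v" "(\<lambda>K. norm_sq M (\<lambda>x. v x - s K x)) \<longlonglongrightarrow> 0"
    and w: "square_integrable M w" "(\<lambda>K. norm_sq M (\<lambda>x. w x - s K x)) \<longlonglongrightarrow> 0"
  shows "AE x in M. v x = w x"
proof -
  have d: "square_integrable M (\<lambda>x. v x - w x)" by (intro square_integrable_diff v w)
  have "norm_sq M (\<lambda>x. v x - w x) \<le> 0"
  proof (rule LIMSEQ_le_const)
    show "(\<lambda>K. 2 * norm_sq M (\<lambda>x. v x - s K x) + 2 * norm_sq M (\<lambda>x. w x - s K x)) \<longlonglongrightarrow> 0"
      using tendsto_add[OF tendsto_mult_right_zero[OF v(2), of 2] tendsto_mult_right_zero[OF w(2), of 2]] by simp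
    have "norm_sq M (\<lambda>x. v x - w x) \<le> 2 * norm_sq M (\<lambda>x. v x - s K x) + 2 * norm_sq M (\<lambda>x. w x - s K x)" for K
    proof -
      have "norm_sq M (\<lambda>x. (v x - s K x) + (s K x - w x)) \<le>
          2 * norm_sq M (\<lambda>x. v x - s K x) + 2 * norm_sq M (\<lambda>x. s K x - w x)"
        by (intro norm_sq_add_le square_integrable_diff v w s)
      then show ?thesis by (simp add: norm_minus_commute[of "s K _"])
    qed
    then show "\<exists>N. \<forall>K\<ge>N. norm_sq M (\<lambda>x. v x - w x) \<le>
        2 * norm_sq M (\<lambda>x. v x - s K x) + 2 * norm_sq M (\<lambda>x. w x - s K x)" by blast
  qed
  then have "norm_sq M (\<lambda>x. v x - w x) = 0" by (intro antisym) simp_all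
  from norm_sq_eq_0_AE[OF d this] show ?thesis by simp
qed

lemma multiplies_unique:
  assumes "multiplies L m u v" "multiplies L m u w"
  shows "AE x in circle_measure L. v x = w x"
  by (rule AE_eq_of_approx[where s = "multiplier_sum L m u"])
    (use assms in \<open>simp_all add: multiplies_def square_integrable_multiplier_sum\<close>)

lemma multiplies_add:
  assumes L: "L > 0" and u: "square_integrable (circle_measure L) u" "square_integrable (circle_measure L) u'"
    and v: "multiplies L m u v" "multiplies L m u' v'"
  shows "multiplies L m (\<lambda>x. u x + u' x) (\<lambda>x. v x + v' x)"
proof -
  let ?M = "circle_measure L" and ?s = "multiplier_sum L m"
  have sv: "square_integrable ?M v" "square_integrable ?M v'"
    and lim: "(\<lambda>K. norm_sq ?M (\<lambda>x. v x - ?s u K x)) \<longlonglongrightarrow> 0" "(\<lambda>K. norm_sq ?M (\<lambda>x. v' x - ?s u' K x)) \<longlonglongrightarrow> 0"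
    using v by (auto simp: multiplies_def)
  have sum: "?s (\<lambda>x. u x + u' x) K x = ?s u K x + ?s u' K x" for K x
    by (simp add: multiplier_sum_def trig_sum_def fourier_coeff_add[OF L u] sum.distrib algebra_simps)
  have "(\<lambda>K. norm_sq ?M (\<lambda>x. (v x + v' x) - ?s (\<lambda>x. u x + u' x) K x)) \<longlonglongrightarrow> 0"
  proof (rule tendsto_sandwich[OF _ _ tendsto_const])
    show "(\<lambda>K. 2 * norm_sq ?M (\<lambda>x. v x - ?s u K x) + 2 * norm_sq ?M (\<lambda>x. v' x - ?s u' K x)) \<longlonglongrightarrow> 0"
      using tendsto_add[OF tendsto_mult_right_zero[OF lim(1), of 2] tendsto_mult_right_zero[OF lim(2), of 2]] by simp
    have "norm_sq ?M (\<lambda>x. (v x + v' x) - ?s (\<lambda>x. u x + u' x) K x) \<le>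
        2 * norm_sq ?M (\<lambda>x. v x - ?s u K x) + 2 * norm_sq ?M (\<lambda>x. v' x - ?s u' K x)" for K
    proof -
      have "norm_sq ?M (\<lambda>x. (v x - ?s u K x) + (v' x - ?s u' K x)) \<le>
          2 * norm_sq ?M (\<lambda>x. v x - ?s u K x) + 2 * norm_sq ?M (\<lambda>x. v' x - ?s u' K x)"
        by (intro norm_sq_add_le square_integrable_diff sv square_integrable_multiplier_sum)
      then show ?thesis by (simp add: sum algebra_simps)
    qed
    then show "\<forall>\<^sub>F K in sequentially. norm_sq ?M (\<lambda>x. (v x + v' x) - ?s (\<lambda>x. u x + u' x) K x) \<le>
        2 * norm_sq ?M (\<lambda>x. v x - ?s u K x) + 2 * norm_sq ?M (\<lambda>x. v' x - ?s u' K x)" by simp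
  qed simp
  then show ?thesis using square_integrable_add[OF sv] by (simp add: multiplies_def)
qed

lemma multiplies_cmult:
  assumes "multiplies L m u v"
  shows "multiplies L m (\<lambda>x. c * u x) (\<lambda>x. c * v x)"
proof -
  let ?M = "circle_measure L" and ?s = "multiplier_sum L m"
  have "c * v x - ?s (\<lambda>x. c * u x) K x = c * (v x - ?s u K x)" for K x
    by (simp add: multiplier_sum_def trig_sum_def fourier_coeff_cmult sum_distrib_left algebra_simps)
  then have "norm_sq ?M (\<lambda>x. c * v x - ?s (\<lambda>x. c * u x) K x) =
      (cmod c)\<^sup>2 * norm_sq ?M (\<lambda>x. v x - ?s u K x)" for K
    by (simp add: norm_mult power_mult_distrib)
  moreover have "(\<lambda>K. (cmod c)\<^sup>2 * norm_sq ?M (\<lambda>x. v x - ?s u K x)) \<longlonglongrightarrow> 0"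
    using assms by (intro tendsto_mult_right_zero) (simp add: multiplies_def)
  ultimately show ?thesis
    using assms square_integrable_cmult[of ?M v c] by (simp add: multiplies_def)
qed

text \<open>The choice operator selects some image under the multiplier with symbol \<open>f (h \<kappa> / 2)\<close>. All further properties are invariant under changes on null sets, so they hold whichever image is selected.\<close>

lemma fun_of_X_multiplies:
  assumes L: "L > 0" and u: "u \<in> L2_circle L" and f: "bounded (range f)"
  shows "multiplies L (\<lambda>k. complex_of_real (f (h * wavenumber L k / 2))) u (fun_of_X L h f u)"
proof -
  let ?m = "\<lambda>k. complex_of_real (f (h * wavenumber L k / 2))"
  have eq: "(v \<in> L2_circle L \<and>
        (\<lambda>K. L2_norm_circle L (\<lambda>x. v x -
            (\<Sum>k = - int K..int K. complex_of_real (f (h * wavenumber L k / 2)) *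
                fourier_coeff L u k * cis (wavenumber L k * x)))) \<longlonglongrightarrow> 0) \<longleftrightarrow> multiplies L ?m u v" for v
  proof -
    have "(\<lambda>K. sqrt (a K)) \<longlonglongrightarrow> 0 \<longleftrightarrow> a \<longlonglongrightarrow> 0" if "\<And>K. 0 \<le> a K" for a :: "nat \<Rightarrow> real"
    proof
      assume "(\<lambda>K. sqrt (a K)) \<longlonglongrightarrow> 0"
      from tendsto_power[OF this, of 2] that show "a \<longlonglongrightarrow> 0" by simp
    next
      assume "a \<longlonglongrightarrow> 0"
      from tendsto_real_sqrt[OF this] show "(\<lambda>K. sqrt (a K)) \<longlonglongrightarrow> 0" by simp
    qed
    then show ?thesis
      by (simp add: L2_circle_iff L2_norm_circle_norm_sq multiplies_def multiplier_sum_def trig_sum_def)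
  qed
  obtain B where "\<forall>y\<in>range f. norm y \<le> B" using f unfolding bounded_iff by blast
  then have "\<bar>f x\<bar> \<le> B" for x by simp
  then have "\<exists>v. multiplies L ?m u v"
    using u by (intro multiplies_exists[OF L, of _ _ B]) (auto simp: L2_circle_iff)
  then have "multiplies L ?m u (SOME v. multiplies L ?m u v)" by (rule someI_ex)
  then show ?thesis unfolding fun_of_X_def eq .
qed

lemma fun_of_X_bounded:
  assumes L: "L > 0" and f: "bounded (range f)"
  shows "bounded_operator_L2 L (fun_of_X L h f)"
proof -
  let ?A = "fun_of_X L h f" and ?m = "\<lambda>k. complex_of_real (f (h * wavenumber L k / 2))"
  note mult = fun_of_X_multiplies[OF L _ f, of _ h]
  obtain B where "\<forall>y\<in>range f. norm y \<le> B" using f unfolding bounded_iff by blast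
  then have B: "\<bar>f x\<bar> \<le> B" for x by simp
  have "?A u \<in> L2_circle L" if "u \<in> L2_circle L" for u
    using mult[OF that] by (simp add: multiplies_def L2_circle_iff)
  moreover have "AE x in circle_measure L. ?A (\<lambda>y. u y + v y) x = ?A u x + ?A v x"
    if "u \<in> L2_circle L" "v \<in> L2_circle L" for u v
  proof (rule multiplies_unique)
    show "multiplies L ?m (\<lambda>y. u y + v y) (?A (\<lambda>y. u y + v y))"
      using that square_integrable_add by (intro mult) (auto simp: L2_circle_iff)
    show "multiplies L ?m (\<lambda>y. u y + v y) (\<lambda>x. ?A u x + ?A v x)"
      using that by (intro multiplies_add[OF L] mult) (auto simp: L2_circle_iff)
  qed
  moreover have "AE x in circle_measure L. ?A (\<lambda>y. c * u y) x = c * ?A u x" if "u \<in> L2_circle L" for u c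
  proof (rule multiplies_unique)
    show "multiplies L ?m (\<lambda>y. c * u y) (?A (\<lambda>y. c * u y))"
      using that square_integrable_cmult by (intro mult) (auto simp: L2_circle_iff)
    show "multiplies L ?m (\<lambda>y. c * u y) (\<lambda>x. c * ?A u x)"
      by (rule multiplies_cmult[OF mult[OF that]])
  qed
  moreover have "L2_norm_circle L (?A u) \<le> sqrt (2 * B\<^sup>2) * L2_norm_circle L u" if "u \<in> L2_circle L" for u
  proof -
    have "norm_sq (circle_measure L) (?A u) \<le> 2 * B\<^sup>2 * norm_sq (circle_measure L) u"
      by (rule multiplies_norm_bound[OF L _ _ mult[OF that]]) (use B that in \<open>auto simp: L2_circle_iff\<close>)
    then show ?thesis
      unfolding L2_norm_circle_norm_sq real_sqrt_mult[symmetric] by (rule real_sqrt_le_mono)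
  qed
  ultimately show ?thesis unfolding bounded_operator_L2_def by blast
qed

section \<open>The conditions taken together\<close>

text \<open>If \<open>\<psi>\<close> vanished near the origin, \<open>defining_identity\<close> at \<open>t = 0\<close> would force \<open>\<phi>(0, x\<^sup>2) = 0\<close> for small \<open>x \<noteq> 0\<close>.\<close>

lemma normalised_imp_psi_nonzero:
  assumes \<phi>: "analytic_near_00 \<phi>" "defines_phi \<theta> \<psi> \<phi>" and one: "\<forall>\<^sub>F y in nhds 0. \<phi> 0 y = 1"
  shows "\<not> (\<forall>\<^sub>F x in nhds 0. \<psi> x = 0)"
proof
  assume "\<forall>\<^sub>F x in nhds 0. \<psi> x = 0"
  then obtain d1 where d1: "d1 > 0" "\<And>x. \<bar>x\<bar> < d1 \<Longrightarrow> \<psi> x = 0"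
    unfolding eventually_nhds_0 by blast
  obtain d2 where d2: "d2 > 0" "\<And>y. \<bar>y\<bar> < d2 \<Longrightarrow> \<phi> 0 y = 1"
    using one unfolding eventually_nhds_0 by blast
  obtain d3 where d3: "d3 > 0" and id: "\<And>t x. \<bar>t\<bar> < d3 \<Longrightarrow> \<bar>x\<bar> < d3 \<Longrightarrow>
      complex_of_real ((cos t)\<^sup>2 * ((tan t)\<^sup>2 - x\<^sup>2)) * (\<phi> (t\<^sup>2) (x\<^sup>2))\<^sup>2 =
         (\<psi> x)\<^sup>2 * (complex_of_real (t\<^sup>2) - (\<theta> x)\<^sup>2)"
    using defining_identity[OF \<phi>] unfolding eventually_nhds_00 by blast
  obtain x where x: "0 < x" "x < min (min d1 d2) (min d3 1)"
    using dense[of 0 "min (min d1 d2) (min d3 1)"] d1(1) d2(1) d3 by auto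
  then have "\<phi> 0 (x\<^sup>2) = 1" by (intro d2(2) square_abs_less) auto
  with id[of 0 x] d1(2)[of x] x show False by simp
qed

lemma phi_exists_canonical_psi:
  assumes \<theta>: "arctan_up_to_sign \<theta>" and an: "analytic_near_0 \<psi>"
    and \<psi>: "\<forall>\<^sub>F x in nhds 0. \<psi> x = complex_of_real (arctan_quot x)"
  shows "\<exists>\<phi>. analytic_near_00 \<phi> \<and> defines_phi \<theta> \<psi> \<phi> \<and> (\<forall>\<^sub>F y in nhds 0. \<phi> 0 y = 1)"
proof -
  obtain d where "d > 0" "\<And>x. \<bar>x\<bar> < d \<Longrightarrow> \<psi> x = complex_of_real (arctan_quot x)"
    using \<psi> unfolding eventually_nhds_0 by blast
  then have "\<forall>\<^sub>F x in nhds 0. \<psi> (- x) = \<psi> x"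
    unfolding eventually_nhds_0 by (intro exI[of _ d]) (simp add: arctan_quot_minus)
  from phi_exists[OF an this \<theta>] obtain \<phi> where \<phi>: "analytic_near_00 \<phi>" "defines_phi \<theta> \<psi> \<phi>" by blast
  with normalisation_iff[OF an \<theta> \<phi>] \<psi> show ?thesis by blast
qed

theorem mainTheorem2:
  shows
    "(analytic_near_0 (\<lambda>x. complex_of_real (arctan x)) \<and>
     analytic_near_0 (\<lambda>x. complex_of_real (arctan_quot x)) \<and>
     (\<exists>\<phi>. analytic_near_00 \<phi> \<and>
        defines_phi (\<lambda>x. complex_of_real (arctan x)) (\<lambda>x. complex_of_real (arctan_quot x)) \<phi> \<and>
        (\<forall>\<^sub>F y in nhds 0. \<phi> 0 y = 1))) \<and>
    (\<forall>\<theta> \<psi> \<phi>. analytic_near_0 \<theta> \<and> analytic_near_0 \<psi> \<and> analytic_near_00 \<phi> \<and>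
        defines_phi \<theta> \<psi> \<phi> \<longrightarrow>
      (\<forall>\<^sub>F (t, x) in nhds (0, 0).
         complex_of_real ((cos t)\<^sup>2 * ((tan t)\<^sup>2 - x\<^sup>2)) * (\<phi> (t\<^sup>2) (x\<^sup>2))\<^sup>2 =
         (\<psi> x)\<^sup>2 * (complex_of_real (t\<^sup>2) - (\<theta> x)\<^sup>2))) \<and>
    \<comment> \<open>\<open>\<phi>0\<close>: the right-hand side is a function of \<open>t\<^sup>2\<close> and \<open>x\<^sup>2\<close>, not necessarily analytic\<close>
    (\<forall>\<theta> \<psi> \<phi>0. analytic_near_0 \<theta> \<and> analytic_near_0 \<psi> \<and> \<not> (\<forall>\<^sub>F x in nhds 0. \<psi> x = 0) \<and>
        defines_phi \<theta> \<psi> \<phi>0 \<longrightarrow>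
      ((\<exists>\<phi>. analytic_near_00 \<phi> \<and> defines_phi \<theta> \<psi> \<phi>) \<longleftrightarrow> arctan_up_to_sign \<theta>)) \<and>
    (\<forall>\<theta> \<psi> \<phi>. analytic_near_0 \<psi> \<and> arctan_up_to_sign \<theta> \<and> analytic_near_00 \<phi> \<and> defines_phi \<theta> \<psi> \<phi> \<longrightarrow>
      ((\<forall>\<^sub>F y in nhds 0. \<phi> 0 y = 1) \<longleftrightarrow>
       (\<forall>\<^sub>F x in nhds 0. \<psi> x = complex_of_real (arctan_quot x)))) \<and>
    (\<forall>\<theta> \<psi>. analytic_near_0 \<theta> \<and> analytic_near_0 \<psi> \<longrightarrow>
      ((\<exists>\<phi>. analytic_near_00 \<phi> \<and> defines_phi \<theta> \<psi> \<phi> \<and> (\<forall>\<^sub>F y in nhds 0. \<phi> 0 y = 1)) \<longleftrightarrow>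
       arctan_up_to_sign \<theta> \<and> (\<forall>\<^sub>F x in nhds 0. \<psi> x = complex_of_real (arctan_quot x)))) \<and>
    (\<forall>t x. \<bar>t\<bar> < pi / 2 \<and> (tan t)\<^sup>2 \<noteq> x\<^sup>2 \<longrightarrow>
       arctan_quot x / cos t * sqrt ((t\<^sup>2 - (arctan x)\<^sup>2) / ((tan t)\<^sup>2 - x\<^sup>2)) = phi_formula t x) \<and>
    (\<forall>\<phi>. analytic_near_00 \<phi> \<and>
        defines_phi (\<lambda>x. complex_of_real (arctan x)) (\<lambda>x. complex_of_real (arctan_quot x)) \<phi> \<longrightarrow>
      (\<forall>\<^sub>F (t, x) in nhds (0, 0). \<phi> (t\<^sup>2) (x\<^sup>2) = complex_of_real (phi_mid t x))) \<and>
    (\<forall>x. \<exists>r>0. \<forall>t. \<bar>t\<bar> < r \<longrightarrow> (\<lambda>n. phi_coeff n x * t ^ n) sums phi_mid t x) \<and>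
    (\<forall>n. bounded (range (phi_coeff n))) \<and>
    (\<forall>h L N. h > 0 \<and> L > 0 \<longrightarrow>
       (\<exists>A. (\<forall>n\<le>N. A n = fun_of_X L h (phi_coeff n) \<and> bounded_operator_L2 L (A n)) \<and>
            (\<forall>u t x. truncated_phi L h N u t x = (\<Sum>n\<le>N. A n ((time_op h ^^ n) u t) x))))"
proof (intro conjI)
  have \<theta>: "arctan_up_to_sign (\<lambda>x. complex_of_real (arctan x))"
    by (simp add: arctan_up_to_sign_def)
  show "analytic_near_0 (\<lambda>x. complex_of_real (arctan x))" by (rule analytic_near_0_arctan)
  show an: "analytic_near_0 (\<lambda>x. complex_of_real (arctan_quot x))" by (rule analytic_near_0_arctan_quot)
  show "\<exists>\<phi>. analytic_near_00 \<phi> \<and>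
        defines_phi (\<lambda>x. complex_of_real (arctan x)) (\<lambda>x. complex_of_real (arctan_quot x)) \<phi> \<and>
        (\<forall>\<^sub>F y in nhds 0. \<phi> 0 y = 1)"
    by (rule phi_exists_canonical_psi[OF \<theta> an]) simp
  show "\<forall>\<theta> \<psi> \<phi>. analytic_near_0 \<theta> \<and> analytic_near_0 \<psi> \<and> analytic_near_00 \<phi> \<and>
        defines_phi \<theta> \<psi> \<phi> \<longrightarrow>
      (\<forall>\<^sub>F (t, x) in nhds (0, 0).
         complex_of_real ((cos t)\<^sup>2 * ((tan t)\<^sup>2 - x\<^sup>2)) * (\<phi> (t\<^sup>2) (x\<^sup>2))\<^sup>2 =
         (\<psi> x)\<^sup>2 * (complex_of_real (t\<^sup>2) - (\<theta> x)\<^sup>2))"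
    using defining_identity by blast
  show "\<forall>\<theta> \<psi> \<phi>0. analytic_near_0 \<theta> \<and> analytic_near_0 \<psi> \<and> \<not> (\<forall>\<^sub>F x in nhds 0. \<psi> x = 0) \<and>
        defines_phi \<theta> \<psi> \<phi>0 \<longrightarrow>
      ((\<exists>\<phi>. analytic_near_00 \<phi> \<and> defines_phi \<theta> \<psi> \<phi>) \<longleftrightarrow> arctan_up_to_sign \<theta>)"
    using theta_necessary phi_exists psi_even by blast
  show "\<forall>\<theta> \<psi> \<phi>. analytic_near_0 \<psi> \<and> arctan_up_to_sign \<theta> \<and> analytic_near_00 \<phi> \<and> defines_phi \<theta> \<psi> \<phi> \<longrightarrow>
      ((\<forall>\<^sub>F y in nhds 0. \<phi> 0 y = 1) \<longleftrightarrow>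
       (\<forall>\<^sub>F x in nhds 0. \<psi> x = complex_of_real (arctan_quot x)))"
    using normalisation_iff by blast
  show "\<forall>\<theta> \<psi>. analytic_near_0 \<theta> \<and> analytic_near_0 \<psi> \<longrightarrow>
      ((\<exists>\<phi>. analytic_near_00 \<phi> \<and> defines_phi \<theta> \<psi> \<phi> \<and> (\<forall>\<^sub>F y in nhds 0. \<phi> 0 y = 1)) \<longleftrightarrow>
       arctan_up_to_sign \<theta> \<and> (\<forall>\<^sub>F x in nhds 0. \<psi> x = complex_of_real (arctan_quot x)))"
  proof (intro allI impI iffI)
    fix \<theta> \<psi>
    assume an: "analytic_near_0 \<theta> \<and> analytic_near_0 \<psi>"
      and "\<exists>\<phi>. analytic_near_00 \<phi> \<and> defines_phi \<theta> \<psi> \<phi> \<and> (\<forall>\<^sub>F y in nhds 0. \<phi> 0 y = 1)"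
    then obtain \<phi> where \<phi>: "analytic_near_00 \<phi>" "defines_phi \<theta> \<psi> \<phi>" and one: "\<forall>\<^sub>F y in nhds 0. \<phi> 0 y = 1"
      by blast
    have "arctan_up_to_sign \<theta>"
      using an by (intro theta_necessary[OF _ _ normalised_imp_psi_nonzero[OF \<phi> one] \<phi>]) auto
    with normalisation_iff[OF _ this \<phi>] an one
    show "arctan_up_to_sign \<theta> \<and> (\<forall>\<^sub>F x in nhds 0. \<psi> x = complex_of_real (arctan_quot x))" by blast
  next
    fix \<theta> \<psi>
    assume "analytic_near_0 \<theta> \<and> analytic_near_0 \<psi>"
      and "arctan_up_to_sign \<theta> \<and> (\<forall>\<^sub>F x in nhds 0. \<psi> x = complex_of_real (arctan_quot x))"
    then show "\<exists>\<phi>. analytic_near_00 \<phi> \<and> defines_phi \<theta> \<psi> \<phi> \<and> (\<forall>\<^sub>F y in nhds 0. \<phi> 0 y = 1)"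
      by (intro phi_exists_canonical_psi) auto
  qed
  show "\<forall>t x. \<bar>t\<bar> < pi / 2 \<and> (tan t)\<^sup>2 \<noteq> x\<^sup>2 \<longrightarrow>
       arctan_quot x / cos t * sqrt ((t\<^sup>2 - (arctan x)\<^sup>2) / ((tan t)\<^sup>2 - x\<^sup>2)) = phi_formula t x"
    using phi_formula_alt by blast
  show "\<forall>\<phi>. analytic_near_00 \<phi> \<and>
        defines_phi (\<lambda>x. complex_of_real (arctan x)) (\<lambda>x. complex_of_real (arctan_quot x)) \<phi> \<longrightarrow>
      (\<forall>\<^sub>F (t, x) in nhds (0, 0). \<phi> (t\<^sup>2) (x\<^sup>2) = complex_of_real (phi_mid t x))"
    using phi_germ_phi_mid by blast
  show "\<forall>x. \<exists>r>0. \<forall>t. \<bar>t\<bar> < r \<longrightarrow> (\<lambda>n. phi_coeff n x * t ^ n) sums phi_mid t x"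
    using phi_coeff_sums by (intro allI exI[of _ "3 / 2"]) simp
  show "\<forall>n. bounded (range (phi_coeff n))"
    using phi_coeff_bounded by blast
  show "\<forall>h L N. h > 0 \<and> L > 0 \<longrightarrow>
       (\<exists>A. (\<forall>n\<le>N. A n = fun_of_X L h (phi_coeff n) \<and> bounded_operator_L2 L (A n)) \<and>
            (\<forall>u t x. truncated_phi L h N u t x = (\<Sum>n\<le>N. A n ((time_op h ^^ n) u t) x)))"
  proof (intro allI impI)
    fix h L :: real and N :: nat
    assume "h > 0 \<and> L > 0"
    then show "\<exists>A. (\<forall>n\<le>N. A n = fun_of_X L h (phi_coeff n) \<and> bounded_operator_L2 L (A n)) \<and>
            (\<forall>u t x. truncated_phi L h N u t x = (\<Sum>n\<le>N. A n ((time_op h ^^ n) u t) x))"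
      by (intro exI[of _ "\<lambda>n. fun_of_X L h (phi_coeff n)"])
        (simp add: fun_of_X_bounded phi_coeff_bounded truncated_phi_def)
  qed
qed

end
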